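(* For Finsler spaces with nonconstant flag curvature, being an isoparametric hypersurface and being a hypersurface with constant principal curvatures are not equivalent properties. More precisely: (i) there exist a Finsler manifold $(N,F)$ with nonconstant flag curvature and an embedded hypersurface $M\subset N$ which is isoparametric but whose principal curvatures are not all constant; (ii) there exist a Finsler manifold $(N,F)$ with nonconstant flag curvature and an embedded hypersurface $M\subset N$ all of whose principal curvatures are constant but which is not isoparametric.
   Context: $(N,F)$ is a smooth connected $n$-dimensional Finsler manifold, with local coordinates $(x,y)=(x^i,y^i)$ on $TN$. Its fundamental tensor is $g_{ij}(x,y)=\frac12[F^2]_{y^iy^j}$, and for $w\in T_xN\setminus\{0\}$ write $g_w=g_{ij}(x,w)dx^i\otimes dx^j$. The geodesic coefficients are $G^i=\frac14 g^{il}\{[F^2]_{x^ky^l}y^k-[F^2]_{x^l}\}$, and $N^i_j=\partial G^i/\partial y^j=\Gamma^i_{jk}y^k$, where $\Gamma^i_{jk}(x,y)$ are the Chern connection coefficients. Unit-speed geodesics satisfy $\ddot\gamma^i+2G^i(\gamma,\dot\gamma)=0$, $F(\dot\gamma)=1$. The covariant derivative of a vector field $X$ in direction $v$ with reference vector $w\neq0$ is $D^w_vX=\{v^j\frac{\partial X^i}{\partial x^j}+\Gamma^i_{jk}(w)v^jX^k\}\frac{\partial}{\partial x^i}$. Flag curvature is the usual Finslerian flag curvature $K(y,V)$ (for a flagpole $y$ and a transverse edge $V$); it is nonconstant if $K$ is not the same constant for all points and all flags. Let $M\subset N$ be an embedded hypersurface with a chosen unit normal field $\mathbf n$ along $M$,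 i.e. $F(\mathbf n)=1$ and $g_{\mathbf n}(\mathbf n,X)=0$ for all $X\in TM$. The shape operator $A_{\mathbf n}:TM\to TM$ is defined by $D^{\mathbf n}_X\mathbf n=-A_{\mathbf n}X$, that is, $-(A_{\mathbf n}X)^i=X(\mathbf n^i)+N^i_j(\mathbf n)X^j$. Its eigenvalues $\mu_1,\dots,\mu_{n-1}$ are the principal curvatures of $M$, and $\hat H_{\mathbf n}=\sum_{a=1}^{n-1}\mu_a$ is the anisotropic mean curvature. For small $t>0$, the parallel hypersurface $M_t$ at distance $t$ consists of the points $\gamma_p(t)$, $p\in M$, where $\gamma_p$ is the unit-speed geodesic of $F$ with $\gamma_p(0)=p$, $\dot\gamma_p(0)=\mathbf n(p)$; it carries the unit normal field $\dot\gamma_p(t)$. The hypersurface $M$ is called isoparametric if $M$ and all its sufficiently close parallel hypersurfaces $M_t$ have constant anisotropic mean curvature. *)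

theory Defs
  imports
    "HOL-Analysis.Analysis"
    "Jordan_Normal_Form.Char_Poly"
    "Jordan_Normal_Form.Gauss_Jordan_Elimination"
begin

section \<open>Smooth functions on open subsets of n-dimensional Euclidean space\<close>

text \<open>
  Since the dimension is quantified over in the theorem, R^n is not indexed by a type:
  its points are the functions nat to real vanishing from index n on, i.e.
  the carrier of the library's \<^const>\<open>Euclidean_space\<close>.
\<close>

abbreviation Rn :: "nat \<Rightarrow> (nat \<Rightarrow> real) set" where
  "Rn n \<equiv> topspace (Euclidean_space n)"

definition pd :: "nat \<Rightarrow> ((nat \<Rightarrow> real) \<Rightarrow> real) \<Rightarrow> (nat \<Rightarrow> real) \<Rightarrow> real" where
  "pd i f x = deriv (\<lambda>t. f (x(i := t))) (x i)"

fun pds :: "nat list \<Rightarrow> ((nat \<Rightarrow> real) \<Rightarrow> real) \<Rightarrow> (nat \<Rightarrow> real) \<Rightarrow> real" where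
  "pds [] f = f"
| "pds (i # is) f = pd i (pds is f)"

text \<open>
  C-infinity on S (used for S open in R^n): all iterated partial derivatives exist and are
  continuous. The explicit differentiability is needed because \<^const>\<open>deriv\<close> is total.
\<close>

definition smooth_fun :: "nat \<Rightarrow> (nat \<Rightarrow> real) set \<Rightarrow> ((nat \<Rightarrow> real) \<Rightarrow> real) \<Rightarrow> bool" where
  "smooth_fun n S f \<longleftrightarrow>
     (\<forall>is. set is \<subseteq> {..<n} \<longrightarrow>
        continuous_on S (pds is f) \<and>
        (\<forall>x\<in>S. \<forall>i<n. (\<lambda>t. pds is f (x(i := t))) differentiable (at (x i))))"


section \<open>Smooth manifolds\<close>

type_synonym 'a chart = "'a set \<times> ('a \<Rightarrow> nat \<Rightarrow> real)"

text \<open>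
  A tangent vector at a point is the assignment, to every chart of the atlas around that point,
  of its component vector in that chart, subject to the usual transformation law (see
  \<open>tangent_space\<close> below); the value at all other charts is 0 by convention.
\<close>

type_synonym 'a tvec = "'a chart \<Rightarrow> nat \<Rightarrow> real"

text \<open>
  A type of points has to be fixed when manifolds are quantified over existentially;
  nat to real is no restriction, as by Whitney's theorem every (Hausdorff, second countable)
  manifold embeds in some R^m. The atlas need not be maximal.
\<close>

record 'a finsler =
  fdim :: nat
  fspace :: "'a topology"
  atlas :: "'a chart set"
  fnorm :: "'a \<Rightarrow> 'a tvec \<Rightarrow> real"

abbreviation cdom :: "'a chart \<Rightarrow> 'a set" where
  "cdom c \<equiv> fst c"

abbreviation cmap :: "'a chart \<Rightarrow> 'a \<Rightarrow> nat \<Rightarrow> real" where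
  "cmap c \<equiv> snd c"

abbreviation crange :: "'a chart \<Rightarrow> (nat \<Rightarrow> real) set" where
  "crange c \<equiv> cmap c ` cdom c"

definition cinv :: "'a chart \<Rightarrow> (nat \<Rightarrow> real) \<Rightarrow> 'a" where
  "cinv c = inv_into (cdom c) (cmap c)"

definition is_chart :: "nat \<Rightarrow> 'a topology \<Rightarrow> 'a chart \<Rightarrow> bool" where
  "is_chart n X c \<longleftrightarrow>
     openin X (cdom c) \<and> openin (Euclidean_space n) (crange c) \<and>
     homeomorphic_map (subtopology X (cdom c)) (subtopology (Euclidean_space n) (crange c)) (cmap c)"

definition smooth_transition :: "nat \<Rightarrow> 'a chart \<Rightarrow> 'a chart \<Rightarrow> bool" where
  "smooth_transition n c d \<longleftrightarrow>
     (\<forall>i<n. smooth_fun n (cmap c ` (cdom c \<inter> cdom d)) (\<lambda>x. cmap d (cinv c x) i))"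

definition smooth_atlas :: "nat \<Rightarrow> 'a topology \<Rightarrow> 'a chart set \<Rightarrow> bool" where
  "smooth_atlas n X A \<longleftrightarrow>
     (\<forall>c\<in>A. is_chart n X c) \<and> (\<Union>c\<in>A. cdom c) = topspace X \<and>
     (\<forall>c\<in>A. \<forall>d\<in>A. smooth_transition n c d)"

definition connected_smooth_manifold :: "nat \<Rightarrow> 'a topology \<Rightarrow> 'a chart set \<Rightarrow> bool" where
  "connected_smooth_manifold n X A \<longleftrightarrow>
     Hausdorff_space X \<and> second_countable X \<and> connected_space X \<and> smooth_atlas n X A"

definition charts_at :: "('a, 'b) finsler_scheme \<Rightarrow> 'a \<Rightarrow> 'a chart set" where
  "charts_at N p = {c \<in> atlas N. p \<in> cdom c}"

text \<open>Components in the chart d of the vector at p whose components in the chart c are y.\<close>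

definition push :: "('a, 'b) finsler_scheme \<Rightarrow> 'a \<Rightarrow> 'a chart \<Rightarrow> 'a chart \<Rightarrow> (nat \<Rightarrow> real) \<Rightarrow> nat \<Rightarrow> real"
  where
  "push N p c d y =
     (\<lambda>i. if i < fdim N then \<Sum>j<fdim N. pd j (\<lambda>x. cmap d (cinv c x) i) (cmap c p) * y j else 0)"

definition tangent_space :: "('a, 'b) finsler_scheme \<Rightarrow> 'a \<Rightarrow> 'a tvec set" where
  "tangent_space N p =
     {v. (\<forall>c. c \<notin> charts_at N p \<longrightarrow> v c = (\<lambda>_. 0)) \<and>
         (\<forall>c\<in>charts_at N p. v c \<in> Rn (fdim N)) \<and>
         (\<forall>c\<in>charts_at N p. \<forall>d\<in>charts_at N p. v d = push N p c d (v c))}"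

definition vec_of :: "('a, 'b) finsler_scheme \<Rightarrow> 'a \<Rightarrow> 'a chart \<Rightarrow> (nat \<Rightarrow> real) \<Rightarrow> 'a tvec" where
  "vec_of N p c y = (\<lambda>d. if d \<in> charts_at N p then push N p c d y else (\<lambda>_. 0))"

definition smooth_curve :: "('a, 'b) finsler_scheme \<Rightarrow> real set \<Rightarrow> (real \<Rightarrow> 'a) \<Rightarrow> bool" where
  "smooth_curve N J \<sigma> \<longleftrightarrow>
     continuous_map (top_of_set J) (fspace N) \<sigma> \<and>
     (\<forall>s\<in>J. \<forall>c\<in>charts_at N (\<sigma> s). \<forall>i<fdim N. \<forall>k.
        (deriv ^^ k) (\<lambda>s. cmap c (\<sigma> s) i) differentiable (at s))"

definition velocity :: "('a, 'b) finsler_scheme \<Rightarrow> (real \<Rightarrow> 'a) \<Rightarrow> real \<Rightarrow> 'a tvec" where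
  "velocity N \<sigma> s =
     (\<lambda>c i. if c \<in> charts_at N (\<sigma> s) \<and> i < fdim N then deriv (\<lambda>s. cmap c (\<sigma> s) i) s else 0)"


section \<open>Finsler metrics\<close>

definition Floc :: "('a, 'b) finsler_scheme \<Rightarrow> 'a chart \<Rightarrow> (nat \<Rightarrow> real) \<Rightarrow> (nat \<Rightarrow> real) \<Rightarrow> real" where
  "Floc N c x y = fnorm N (cinv c x) (vec_of N (cinv c x) c y)"

definition pdx :: "nat \<Rightarrow> ((nat \<Rightarrow> real) \<Rightarrow> (nat \<Rightarrow> real) \<Rightarrow> real) \<Rightarrow> (nat \<Rightarrow> real) \<Rightarrow> (nat \<Rightarrow> real) \<Rightarrow> real"
  where "pdx i f x y = pd i (\<lambda>x. f x y) x"

definition pdy :: "nat \<Rightarrow> ((nat \<Rightarrow> real) \<Rightarrow> (nat \<Rightarrow> real) \<Rightarrow> real) \<Rightarrow> (nat \<Rightarrow> real) \<Rightarrow> (nat \<Rightarrow> real) \<Rightarrow> real"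
  where "pdy i f x y = pd i (\<lambda>y. f x y) y"

definition gmat :: "('a, 'b) finsler_scheme \<Rightarrow> 'a chart \<Rightarrow> (nat \<Rightarrow> real) \<Rightarrow> (nat \<Rightarrow> real) \<Rightarrow> real mat" where
  "gmat N c x y =
     mat (fdim N) (fdim N) (\<lambda>(i, j). 1/2 * pdy j (pdy i (\<lambda>x y. (Floc N c x y)\<^sup>2)) x y)"

definition ginner :: "('a, 'b) finsler_scheme \<Rightarrow> 'a chart \<Rightarrow> (nat \<Rightarrow> real) \<Rightarrow> (nat \<Rightarrow> real) \<Rightarrow>
    (nat \<Rightarrow> real) \<Rightarrow> (nat \<Rightarrow> real) \<Rightarrow> real" where
  "ginner N c x y u v = (\<Sum>i<fdim N. \<Sum>j<fdim N. gmat N c x y $$ (i, j) * u i * v j)"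

text \<open>
  Local coordinates on the tangent bundle: a point z of R^(2n) encodes the pair (x, y)
  given by its first and last n entries.
\<close>

definition xpart :: "nat \<Rightarrow> (nat \<Rightarrow> real) \<Rightarrow> nat \<Rightarrow> real" where
  "xpart n z = (\<lambda>i. if i < n then z i else 0)"

definition ypart :: "nat \<Rightarrow> (nat \<Rightarrow> real) \<Rightarrow> nat \<Rightarrow> real" where
  "ypart n z = (\<lambda>i. if i < n then z (n + i) else 0)"

definition finsler_manifold :: "('a, 'b) finsler_scheme \<Rightarrow> bool" where
  "finsler_manifold N \<longleftrightarrow>
     connected_smooth_manifold (fdim N) (fspace N) (atlas N) \<and>
     (\<forall>c\<in>atlas N.
        smooth_fun (2 * fdim N)
          {z \<in> Rn (2 * fdim N). xpart (fdim N) z \<in> crange c \<and> ypart (fdim N) z \<noteq> (\<lambda>_. 0)}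
          (\<lambda>z. Floc N c (xpart (fdim N) z) (ypart (fdim N) z)) \<and>
        (\<forall>x\<in>crange c. \<forall>y\<in>Rn (fdim N).
           Floc N c x y \<ge> 0 \<and>
           (\<forall>r>0. Floc N c x (\<lambda>i. r * y i) = r * Floc N c x y) \<and>
           (y \<noteq> (\<lambda>_. 0) \<longrightarrow>
              (\<forall>u\<in>Rn (fdim N). u \<noteq> (\<lambda>_. 0) \<longrightarrow> ginner N c x y u u > 0))))"

definition ginv :: "('a, 'b) finsler_scheme \<Rightarrow> 'a chart \<Rightarrow> (nat \<Rightarrow> real) \<Rightarrow> (nat \<Rightarrow> real) \<Rightarrow> real mat" where
  "ginv N c x y = the (mat_inverse (gmat N c x y))"

definition Gcoef :: "('a, 'b) finsler_scheme \<Rightarrow> 'a chart \<Rightarrow> nat \<Rightarrow> (nat \<Rightarrow> real) \<Rightarrow> (nat \<Rightarrow> real) \<Rightarrow> real" where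
  "Gcoef N c i x y =
     1/4 * (\<Sum>l<fdim N. ginv N c x y $$ (i, l) *
        ((\<Sum>k<fdim N. pdx k (pdy l (\<lambda>x y. (Floc N c x y)\<^sup>2)) x y * y k)
          - pdx l (\<lambda>x y. (Floc N c x y)\<^sup>2) x y))"

definition Ncoef :: "('a, 'b) finsler_scheme \<Rightarrow> 'a chart \<Rightarrow> nat \<Rightarrow> nat \<Rightarrow> (nat \<Rightarrow> real) \<Rightarrow> (nat \<Rightarrow> real) \<Rightarrow> real" where
  "Ncoef N c i j x y = pdy j (Gcoef N c i) x y"

definition Riemann :: "('a, 'b) finsler_scheme \<Rightarrow> 'a chart \<Rightarrow> nat \<Rightarrow> nat \<Rightarrow> (nat \<Rightarrow> real) \<Rightarrow> (nat \<Rightarrow> real) \<Rightarrow> real" where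
  "Riemann N c i k x y =
     2 * pdx k (Gcoef N c i) x y
     - (\<Sum>j<fdim N. y j * pdx j (pdy k (Gcoef N c i)) x y)
     + 2 * (\<Sum>j<fdim N. Gcoef N c j x y * pdy j (pdy k (Gcoef N c i)) x y)
     - (\<Sum>j<fdim N. pdy j (Gcoef N c i) x y * pdy k (Gcoef N c j) x y)"

text \<open>
  Flag curvature g_y(R_y V, V) / (g_y(y,y) g_y(V,V) - g_y(y,V)^2), where R_y is the
  Riemann curvature with components R^i_k(x,y) above.
\<close>

definition flag_curvature :: "('a, 'b) finsler_scheme \<Rightarrow> 'a chart \<Rightarrow> (nat \<Rightarrow> real) \<Rightarrow>
    (nat \<Rightarrow> real) \<Rightarrow> (nat \<Rightarrow> real) \<Rightarrow> real" where
  "flag_curvature N c x y V =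
     ginner N c x y (\<lambda>i. \<Sum>k<fdim N. Riemann N c i k x y * V k) V /
     (ginner N c x y y y * ginner N c x y V V - (ginner N c x y y V)\<^sup>2)"

definition constant_flag_curvature :: "('a, 'b) finsler_scheme \<Rightarrow> bool" where
  "constant_flag_curvature N \<longleftrightarrow>
     (\<exists>\<kappa>. \<forall>c\<in>atlas N. \<forall>x\<in>crange c. \<forall>y\<in>Rn (fdim N). \<forall>V\<in>Rn (fdim N).
        y \<noteq> (\<lambda>_. 0) \<and> (\<forall>r. V \<noteq> (\<lambda>i. r * y i)) \<longrightarrow> flag_curvature N c x y V = \<kappa>)"

definition unit_speed_geodesic :: "('a, 'b) finsler_scheme \<Rightarrow> real set \<Rightarrow> (real \<Rightarrow> 'a) \<Rightarrow> bool" where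
  "unit_speed_geodesic N J \<gamma> \<longleftrightarrow>
     smooth_curve N J \<gamma> \<and>
     (\<forall>s\<in>J. fnorm N (\<gamma> s) (velocity N \<gamma> s) = 1 \<and>
        (\<forall>c\<in>charts_at N (\<gamma> s). \<forall>i<fdim N.
           (deriv ^^ 2) (\<lambda>s. cmap c (\<gamma> s) i) s
             + 2 * Gcoef N c i (cmap c (\<gamma> s)) (velocity N \<gamma> s c) = 0))"


section \<open>Hypersurfaces\<close>

definition embedded_hypersurface :: "('a, 'b) finsler_scheme \<Rightarrow> 'a set \<Rightarrow> bool" where
  "embedded_hypersurface N M \<longleftrightarrow>
     M \<subseteq> topspace (fspace N) \<and>
     (\<forall>p\<in>M. \<exists>c. is_chart (fdim N) (fspace N) c \<and>
        (\<forall>d\<in>atlas N. smooth_transition (fdim N) c d \<and> smooth_transition (fdim N) d c) \<and>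
        p \<in> cdom c \<and>
        cmap c ` (M \<inter> cdom c) = {x \<in> crange c. x (fdim N - 1) = 0})"

definition curves_in :: "('a, 'b) finsler_scheme \<Rightarrow> 'a set \<Rightarrow> 'a \<Rightarrow> (real \<Rightarrow> 'a) set" where
  "curves_in N M p =
     {\<sigma>. \<sigma> 0 = p \<and> (\<exists>\<delta>>0. smooth_curve N {-\<delta><..<\<delta>} \<sigma> \<and> \<sigma> ` {-\<delta><..<\<delta>} \<subseteq> M)}"

definition tangent_of :: "('a, 'b) finsler_scheme \<Rightarrow> 'a set \<Rightarrow> 'a \<Rightarrow> 'a tvec set" where
  "tangent_of N M p = (\<lambda>\<sigma>. velocity N \<sigma> 0) ` curves_in N M p"

definition smooth_field_along :: "('a, 'b) finsler_scheme \<Rightarrow> 'a set \<Rightarrow> ('a \<Rightarrow> 'a tvec) \<Rightarrow> bool" where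
  "smooth_field_along N M \<nu> \<longleftrightarrow>
     (\<forall>p\<in>M. \<nu> p \<in> tangent_space N p \<and>
        (\<forall>c\<in>charts_at N p. \<forall>i<fdim N. \<exists>W f.
           openin (fspace N) W \<and> p \<in> W \<and> W \<subseteq> cdom c \<and>
           smooth_fun (fdim N) (cmap c ` W) f \<and> (\<forall>q\<in>M \<inter> W. \<nu> q c i = f (cmap c q))))"

definition unit_normal_field :: "('a, 'b) finsler_scheme \<Rightarrow> 'a set \<Rightarrow> ('a \<Rightarrow> 'a tvec) \<Rightarrow> bool" where
  "unit_normal_field N M \<nu> \<longleftrightarrow>
     smooth_field_along N M \<nu> \<and>
     (\<forall>p\<in>M. fnorm N p (\<nu> p) = 1 \<and>
        (\<forall>X\<in>tangent_of N M p. \<forall>c\<in>charts_at N p.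
           ginner N c (cmap c p) (\<nu> p c) (\<nu> p c) (X c) = 0))"

definition hypersurface_with_normal :: "('a, 'b) finsler_scheme \<Rightarrow> 'a set \<Rightarrow> ('a \<Rightarrow> 'a tvec) \<Rightarrow> bool" where
  "hypersurface_with_normal N M \<nu> \<longleftrightarrow> embedded_hypersurface N M \<and> unit_normal_field N M \<nu>"

text \<open>The derivative X(f) of a function f on M in the direction of a vector X tangent to M at p.\<close>

definition dir_deriv :: "('a, 'b) finsler_scheme \<Rightarrow> 'a set \<Rightarrow> 'a \<Rightarrow> 'a tvec \<Rightarrow> ('a \<Rightarrow> real) \<Rightarrow> real" where
  "dir_deriv N M p X f =
     (THE D. \<forall>\<sigma>\<in>curves_in N M p. velocity N \<sigma> 0 = X \<longrightarrow>
        ((\<lambda>s. f (\<sigma> s)) has_real_derivative D) (at 0))"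

text \<open>
  The shape operator A with D_X n = - A X, the covariant derivative being that of the Chern
  connection with reference vector n: its connection term Gamma^i_jk(n) X^j n^k is N^i_j(n) X^j.
\<close>

definition shape_operator :: "('a, 'b) finsler_scheme \<Rightarrow> 'a set \<Rightarrow> ('a \<Rightarrow> 'a tvec) \<Rightarrow> 'a \<Rightarrow> 'a tvec \<Rightarrow> 'a tvec" where
  "shape_operator N M \<nu> p X =
     (\<lambda>c i. if c \<in> charts_at N p \<and> i < fdim N
        then - (dir_deriv N M p X (\<lambda>q. \<nu> q c i)
                + (\<Sum>j<fdim N. Ncoef N c i j (cmap c p) (\<nu> p c) * X c j))
        else 0)"

definition lincomb_tvec :: "nat \<Rightarrow> (nat \<Rightarrow> real) \<Rightarrow> (nat \<Rightarrow> 'a tvec) \<Rightarrow> 'a tvec" where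
  "lincomb_tvec m a e = (\<lambda>c i. \<Sum>b<m. a b * e b c i)"

definition basis_of :: "'a tvec set \<Rightarrow> nat \<Rightarrow> (nat \<Rightarrow> 'a tvec) \<Rightarrow> bool" where
  "basis_of V m e \<longleftrightarrow>
     (\<forall>b<m. e b \<in> V) \<and> (\<forall>X\<in>V. \<exists>!a. a \<in> Rn m \<and> X = lincomb_tvec m a e)"

text \<open>
  The multiset of eigenvalues of the shape operator at p, counted with algebraic multiplicity:
  the roots of the characteristic polynomial of its matrix B in any basis e of the tangent
  space of M. As the shape operator is self-adjoint for the inner product induced by the normal,
  there are n - 1 of them.
\<close>

definition principal_curvatures ::
    "('a, 'b) finsler_scheme \<Rightarrow> 'a set \<Rightarrow> ('a \<Rightarrow> 'a tvec) \<Rightarrow> 'a \<Rightarrow> real multiset" where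
  "principal_curvatures N M \<nu> p =
     (THE P. \<exists>e B. basis_of (tangent_of N M p) (fdim N - 1) e \<and>
        B \<in> carrier_mat (fdim N - 1) (fdim N - 1) \<and>
        (\<forall>b<fdim N - 1.
           shape_operator N M \<nu> p (e b) = lincomb_tvec (fdim N - 1) (\<lambda>a. B $$ (a, b)) e) \<and>
        P = proots (char_poly B))"

definition mean_curvature :: "('a, 'b) finsler_scheme \<Rightarrow> 'a set \<Rightarrow> ('a \<Rightarrow> 'a tvec) \<Rightarrow> 'a \<Rightarrow> real" where
  "mean_curvature N M \<nu> p = \<Sum>\<^sub># (principal_curvatures N M \<nu> p)"

definition constant_principal_curvatures :: "('a, 'b) finsler_scheme \<Rightarrow> 'a set \<Rightarrow> ('a \<Rightarrow> 'a tvec) \<Rightarrow> bool" where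
  "constant_principal_curvatures N M \<nu> \<longleftrightarrow> (\<exists>P. \<forall>p\<in>M. principal_curvatures N M \<nu> p = P)"

definition constant_mean_curvature :: "('a, 'b) finsler_scheme \<Rightarrow> 'a set \<Rightarrow> ('a \<Rightarrow> 'a tvec) \<Rightarrow> bool" where
  "constant_mean_curvature N M \<nu> \<longleftrightarrow> (\<exists>H. \<forall>p\<in>M. mean_curvature N M \<nu> p = H)"


section \<open>Parallel hypersurfaces\<close>

text \<open>
  The unit-speed geodesics starting normally on M and defined at least on [0, t]. They live on an
  open interval around [0, t], so that velocities at the end points are ordinary derivatives.
\<close>

definition normal_geodesics :: "('a, 'b) finsler_scheme \<Rightarrow> 'a set \<Rightarrow> ('a \<Rightarrow> 'a tvec) \<Rightarrow> real \<Rightarrow> (real \<Rightarrow> 'a) set"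
  where
  "normal_geodesics N M \<nu> t =
     {\<gamma>. \<gamma> 0 \<in> M \<and> velocity N \<gamma> 0 = \<nu> (\<gamma> 0) \<and>
         (\<exists>a b. a < 0 \<and> t < b \<and> unit_speed_geodesic N {a<..<b} \<gamma>)}"

definition parallel_hypersurface :: "('a, 'b) finsler_scheme \<Rightarrow> 'a set \<Rightarrow> ('a \<Rightarrow> 'a tvec) \<Rightarrow> real \<Rightarrow> 'a set" where
  "parallel_hypersurface N M \<nu> t = (\<lambda>\<gamma>. \<gamma> t) ` normal_geodesics N M \<nu> t"

definition parallel_normal :: "('a, 'b) finsler_scheme \<Rightarrow> 'a set \<Rightarrow> ('a \<Rightarrow> 'a tvec) \<Rightarrow> real \<Rightarrow> 'a \<Rightarrow> 'a tvec" where
  "parallel_normal N M \<nu> t q =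
     (THE v. \<exists>\<gamma>\<in>normal_geodesics N M \<nu> t. \<gamma> t = q \<and> velocity N \<gamma> t = v)"

text \<open>
  Standing assumption behind speaking of the parallel hypersurfaces at small distances: for all
  small t > 0 every normal geodesic lasts until time t, their velocities at time t form a
  (single-valued) vector field on the set of their end points, and that set is an embedded
  hypersurface with this field as a unit normal field. (It can fail for noncompact M.)
\<close>

definition has_parallel_hypersurfaces :: "('a, 'b) finsler_scheme \<Rightarrow> 'a set \<Rightarrow> ('a \<Rightarrow> 'a tvec) \<Rightarrow> bool" where
  "has_parallel_hypersurfaces N M \<nu> \<longleftrightarrow>
     (\<exists>\<epsilon>>0. \<forall>t\<in>{0<..<\<epsilon>}.
        (\<forall>p\<in>M. \<exists>\<gamma>\<in>normal_geodesics N M \<nu> t. \<gamma> 0 = p) \<and>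
        (\<forall>\<gamma>\<in>normal_geodesics N M \<nu> t. \<forall>\<eta>\<in>normal_geodesics N M \<nu> t.
           \<gamma> t = \<eta> t \<longrightarrow> velocity N \<gamma> t = velocity N \<eta> t) \<and>
        hypersurface_with_normal N (parallel_hypersurface N M \<nu> t) (parallel_normal N M \<nu> t))"

definition isoparametric :: "('a, 'b) finsler_scheme \<Rightarrow> 'a set \<Rightarrow> ('a \<Rightarrow> 'a tvec) \<Rightarrow> bool" where
  "isoparametric N M \<nu> \<longleftrightarrow>
     constant_mean_curvature N M \<nu> \<and>
     (\<exists>\<epsilon>>0. \<forall>t\<in>{0<..<\<epsilon>}.
        constant_mean_curvature N (parallel_hypersurface N M \<nu> t) (parallel_normal N M \<nu> t))"

end

theory Submission
  imports Defs
begin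

text \<open>
  Both examples are Riemannian metrics e^(2 \<theta>_0) (dx^0)^2 + e^(2 \<theta>_1) (dx^1)^2 + (dx^2)^2 on R^3, with
  \<theta>_0 = p x^0 x^2 + q x^0 (x^2)^2 and \<theta>_1 = - p x^0 x^2. The x^2-lines are the unit-speed geodesics
  normal to M = {x^2 = 0}, so the parallel hypersurfaces are M_t = {x^2 = t}. The shape operator of M_t
  is diagonal in the coordinate frame, with principal curvatures - d\<theta>_0/dx^2 = - p x^0 - 2 q x^0 t and
  - d\<theta>_1/dx^2 = p x^0. For p = 1, q = 0 they are nonconstant with sum 0, for p = 0, q = 1 they
  vanish on M while their sum is nonconstant on M_t for t > 0. The flags spanned by d/dx^2 and d/dx^0 have
  curvature - (d^2 \<theta>_0/(dx^2)^2 + (d\<theta>_0/dx^2)^2), which is nonconstant in both cases.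
\<close>


section \<open>Smooth functions\<close>

lemma Rn_upd: "x \<in> Rn n \<Longrightarrow> i < n \<Longrightarrow> x(i := t) \<in> Rn n"
  by (auto simp: topspace_Euclidean_space)

lemma pd_eqI:
  "((\<lambda>t. f (x(i := t))) has_real_derivative D) (at (x i)) \<Longrightarrow> pd i f x = D"
  unfolding pd_def by (rule DERIV_imp_deriv)

text \<open>By induction on the index list, every iterated partial derivative of \<open>h\<close>
  agrees on \<open>S\<close> with a member of the class, which is continuous and differentiable
  along coordinates. Nothing is known about \<open>h\<close> off \<open>S\<close>; since small
  changes of one coordinate stay in \<open>S\<close>, agreement on \<open>S\<close> still passes to
  derivatives.\<close>

lemma smooth_fun_derivation_closed:
  assumes slice: "\<And>x i. x \<in> S \<Longrightarrow> i < n \<Longrightarrow> \<forall>\<^sub>F t in nhds (x i). x(i := t) \<in> S"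
    and cont: "\<And>f. f \<in> \<F> \<Longrightarrow> continuous_on S f"
    and deriv: "\<And>f i. f \<in> \<F> \<Longrightarrow> i < n \<Longrightarrow>
      \<exists>g\<in>\<F>. \<forall>x\<in>S. ((\<lambda>t. f (x(i := t))) has_real_derivative g x) (at (x i))"
    and f: "f \<in> \<F>" and hf: "\<And>x. x \<in> S \<Longrightarrow> h x = f x"
  shows "smooth_fun n S h"
proof -
  have deriv': "((\<lambda>t. k (x(i := t))) has_real_derivative D) (at (x i))"
    if "((\<lambda>t. g (x(i := t))) has_real_derivative D) (at (x i))"
      and "\<And>x. x \<in> S \<Longrightarrow> k x = g x" and "x \<in> S" "i < n" for g k :: "(nat \<Rightarrow> real) \<Rightarrow> real" and x i D
  proof -
    have "\<forall>\<^sub>F t in nhds (x i). k (x(i := t)) = g (x(i := t))"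
      using slice[OF that(3,4)] by (rule eventually_mono) (use that(2) in auto)
    with that(1) show ?thesis
      by (subst DERIV_cong_ev[OF refl _ refl])
  qed
  have ex: "\<exists>g\<in>\<F>. \<forall>x\<in>S. pds is h x = g x" if "set is \<subseteq> {..<n}" for "is"
    using that
  proof (induction "is")
    case Nil
    then show ?case using f hf by auto
  next
    case (Cons i "is")
    then obtain g where g: "g \<in> \<F>" "\<And>x. x \<in> S \<Longrightarrow> pds is h x = g x" by auto
    have i: "i < n" using Cons.prems by auto
    from deriv[OF g(1) i] obtain g' where g': "g' \<in> \<F>"
      "\<And>x. x \<in> S \<Longrightarrow> ((\<lambda>t. g (x(i := t))) has_real_derivative g' x) (at (x i))" by blast
    have "pds (i # is) h x = g' x" if "x \<in> S" for x
      using pd_eqI[OF deriv'[OF g'(2)[OF that] g(2) _ i]] that by simp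
    with g'(1) show ?case by blast
  qed
  show ?thesis
    unfolding smooth_fun_def
  proof (intro allI impI conjI ballI)
    fix "is" :: "nat list" assume "set is \<subseteq> {..<n}"
    from ex[OF this] obtain g where g: "g \<in> \<F>" "\<And>x. x \<in> S \<Longrightarrow> pds is h x = g x" by auto
    show "continuous_on S (pds is h)"
      using cont[OF g(1)] g(2) continuous_on_cong by metis
    fix x i assume xi: "x \<in> S" "i < n"
    from deriv[OF g(1) xi(2)] xi(1) obtain D where
      "((\<lambda>t. g (x(i := t))) has_real_derivative D) (at (x i))" by blast
    from deriv'[OF this g(2) _ xi(2)] xi(1)
    show "(\<lambda>t. pds is h (x(i := t))) differentiable at (x i)"
      unfolding real_differentiable_def by blast
  qed
qed

text \<open>A class closed under partial derivatives; real powers cover square roots and reciprocals.\<close>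

inductive elementary :: "(nat \<Rightarrow> real) set \<Rightarrow> ((nat \<Rightarrow> real) \<Rightarrow> real) \<Rightarrow> bool"
  for S :: "(nat \<Rightarrow> real) set" where
  const: "elementary S (\<lambda>_. c)"
| coord: "elementary S (\<lambda>x. x i)"
| add: "elementary S f \<Longrightarrow> elementary S g \<Longrightarrow> elementary S (\<lambda>x. f x + g x)"
| mult: "elementary S f \<Longrightarrow> elementary S g \<Longrightarrow> elementary S (\<lambda>x. f x * g x)"
| exp: "elementary S f \<Longrightarrow> elementary S (\<lambda>x. exp (f x))"
| powr: "elementary S f \<Longrightarrow> (\<And>x. x \<in> S \<Longrightarrow> f x > 0) \<Longrightarrow> elementary S (\<lambda>x. f x powr r)"

lemma continuous_on_elementary: "elementary S f \<Longrightarrow> continuous_on S f"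
proof (induction rule: elementary.induct)
  case (coord i)
  show ?case by (rule continuous_on_subset[OF continuous_on_product_coordinates]) simp
next
  case (powr f r)
  then show ?case by (intro continuous_intros) force+
qed (auto intro: continuous_intros)

lemma elementary_derivative:
  "elementary S f \<Longrightarrow>
    \<exists>g. elementary S g \<and> (\<forall>x\<in>S. ((\<lambda>t. f (x(i := t))) has_real_derivative g x) (at (x i)))"
proof (induction rule: elementary.induct)
  case (const c)
  show ?case by (rule exI[of _ "\<lambda>_. 0"]) (auto intro: elementary.const)
next
  case (coord j)
  show ?case
    by (rule exI[of _ "\<lambda>_. if i = j then 1 else 0"])
      (auto intro: elementary.const simp: fun_upd_def)
next
  case (add f g)
  then obtain f' g' where "elementary S f'" "elementary S g'"
    "\<forall>x\<in>S. ((\<lambda>t. f (x(i := t))) has_real_derivative f' x) (at (x i))"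
    "\<forall>x\<in>S. ((\<lambda>t. g (x(i := t))) has_real_derivative g' x) (at (x i))" by blast
  then show ?case
    by (intro exI[of _ "\<lambda>x. f' x + g' x"]) (intro conjI ballI elementary.add DERIV_add; blast)
next
  case (mult f g)
  then obtain f' g' where "elementary S f'" "elementary S g'"
    "\<forall>x\<in>S. ((\<lambda>t. f (x(i := t))) has_real_derivative f' x) (at (x i))"
    "\<forall>x\<in>S. ((\<lambda>t. g (x(i := t))) has_real_derivative g' x) (at (x i))" by blast
  note fg = this
  have "((\<lambda>t. f (x(i := t)) * g (x(i := t))) has_real_derivative f' x * g x + g' x * f x) (at (x i))"
    if "x \<in> S" for x
    using DERIV_mult[OF fg(3)[rule_format, OF that] fg(4)[rule_format, OF that]] by simp
  then show ?case
    using mult.hyps fg(1,2)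
    by (intro exI[of _ "\<lambda>x. f' x * g x + g' x * f x"] conjI ballI elementary.add elementary.mult)
next
  case (exp f)
  then obtain f' where f': "elementary S f'"
    "\<forall>x\<in>S. ((\<lambda>t. f (x(i := t))) has_real_derivative f' x) (at (x i))" by blast
  have "((\<lambda>t. exp (f (x(i := t)))) has_real_derivative exp (f x) * f' x) (at (x i))"
    if "x \<in> S" for x
    using DERIV_fun_exp[OF f'(2)[rule_format, OF that]] by simp
  then show ?case
    using exp.hyps f'(1)
    by (intro exI[of _ "\<lambda>x. exp (f x) * f' x"] conjI ballI elementary.mult elementary.exp)
next
  case (powr f r)
  then obtain f' where f': "elementary S f'"
    "\<And>x. x \<in> S \<Longrightarrow> ((\<lambda>t. f (x(i := t))) has_real_derivative f' x) (at (x i))" by blast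
  have "((\<lambda>t. f (x(i := t)) powr r) has_real_derivative r * f x powr (r - 1) * f' x) (at (x i))"
    if "x \<in> S" for x
    using DERIV_fun_powr[OF f'(2)[OF that], of r] powr.hyps(2)[OF that] by simp
  then show ?case
    using powr.hyps f'(1)
    by (intro exI[of _ "\<lambda>x. r * f x powr (r - 1) * f' x"] conjI ballI
        elementary.mult elementary.const elementary.powr)
qed

lemma smooth_fun_elementary:
  assumes "\<And>x i. x \<in> S \<Longrightarrow> i < n \<Longrightarrow> \<forall>\<^sub>F t in nhds (x i). x(i := t) \<in> S"
    and "elementary S f" and "\<And>x. x \<in> S \<Longrightarrow> h x = f x"
  shows "smooth_fun n S h"
  by (rule smooth_fun_derivation_closed[where \<F> = "Collect (elementary S)" and f = f])
    (use assms in \<open>auto simp: continuous_on_elementary dest: elementary_derivative\<close>)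

lemma smooth_fun_elementary_Rn:
  assumes "elementary (Rn n) f" and "\<And>x. x \<in> Rn n \<Longrightarrow> h x = f x"
  shows "smooth_fun n (Rn n) h"
  by (rule smooth_fun_elementary[OF _ assms]) (auto intro: always_eventually Rn_upd)


section \<open>Linear algebra, topology and a linear differential equation\<close>

text \<open>A one-sided inverse of a square matrix is two-sided, so \<open>A\<close> is a unit and
  \<open>mat_inverse\<close> cannot return \<open>None\<close>. A returned matrix \<open>C\<close>
  equals \<open>B\<close> by C = C (A B) = (C A) B = B.\<close>

lemma mat_inverse_eqI:
  fixes A B :: "real mat"
  assumes A: "A \<in> carrier_mat n n" and B: "B \<in> carrier_mat n n" and AB: "A * B = 1\<^sub>m n"
  shows "mat_inverse A = Some B"
proof (cases "mat_inverse A")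
  case None
  have "B * A = 1\<^sub>m n" by (rule mat_mult_left_right_inverse[OF A B AB])
  with A B AB have "A \<in> Units (ring_mat TYPE(real) n undefined)"
    by (auto simp: Units_def ring_mat_def)
  with mat_inverse(1)[OF A None, of undefined] show ?thesis by blast
next
  case (Some C)
  note C = mat_inverse(2)[OF A Some]
  have "C = C * (A * B)" using C by (simp add: AB right_mult_one_mat[of C n n])
  also have "\<dots> = (C * A) * B" using A B C by (metis assoc_mult_mat)
  also have "\<dots> = B" using B C by simp
  finally show ?thesis using Some by simp
qed

text \<open>The product topology on all real sequences has a countable basis, and
  \<open>Euclidean_space n\<close> is a subspace of it.\<close>

lemma second_countable_Euclidean_space: "second_countable (Euclidean_space n)"
proof -
  obtain B :: "(nat \<Rightarrow> real) set set" where "countable B" "topological_basis B"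
    using ex_countable_basis by blast
  then have "second_countable (euclidean :: (nat \<Rightarrow> real) topology)"
    unfolding second_countable_def
    using topological_basis_open topological_basisE by (metis open_openin)
  then show ?thesis
    by (simp add: Euclidean_space_def euclidean_product_topology second_countable_subtopology)
qed

lemma Hausdorff_Euclidean_space: "Hausdorff_space (Euclidean_space n)"
  by (simp add: Euclidean_space_def Hausdorff_space_subtopology Hausdorff_space_product_topology)

text \<open>Integrating factor: with \<open>B\<close> an antiderivative of \<open>b\<close>, the
  function u exp(-B) has derivative 0. This supplies the uniqueness of normal geodesics without a
  general existence and uniqueness theorem.\<close>

lemma linear_ode_zero:
  fixes u b :: "real \<Rightarrow> real"
  assumes deriv: "\<And>s. s \<in> {0..t} \<Longrightarrow> (u has_real_derivative b s * u s) (at s)"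
    and b: "continuous_on {0..t} b" and "u 0 = 0" and s: "s \<in> {0..t}"
  shows "u s = 0"
proof -
  obtain B where B: "\<And>s. s \<in> {0..t} \<Longrightarrow> (B has_vector_derivative b s) (at s within {0..t})"
    using antiderivative_continuous[OF b] by blast
  have "((\<lambda>s. u s * exp (- B s)) has_real_derivative 0) (at s within {0..t})"
    if "s \<in> {0..t}" for s
  proof -
    have "(u has_real_derivative b s * u s) (at s within {0..t})"
      using deriv[OF that] by (rule has_field_derivative_at_within)
    moreover have "(B has_real_derivative b s) (at s within {0..t})"
      using B[OF that] by (simp add: has_real_derivative_iff_has_vector_derivative)
    ultimately show ?thesis
      by (auto intro!: derivative_eq_intros)
  qed
  then obtain c where c: "\<And>s. s \<in> {0..t} \<Longrightarrow> u s * exp (- B s) = c"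
    using has_field_derivative_zero_constant[of "{0..t}" "\<lambda>s. u s * exp (- B s)"] by auto
  have "u s * exp (- B s) = u 0 * exp (- B 0)"
    using c[OF s] c[of 0] s by simp
  with \<open>u 0 = 0\<close> show ?thesis by simp
qed


section \<open>The metric\<close>

lemma sum_lessThan_3: "(\<Sum>i<3. f i) = f 0 + f 1 + f 2" for f :: "nat \<Rightarrow> 'a::comm_monoid_add"
  by (simp add: numeral_3_eq_3 numeral_2_eq_2)

lemma less_3_cases: "i < 3 \<longleftrightarrow> i = 0 \<or> i = 1 \<or> i = 2" for i :: nat
  by auto

context
  fixes p q :: real
begin

definition \<theta> :: "nat \<Rightarrow> (nat \<Rightarrow> real) \<Rightarrow> real" where
  "\<theta> k x =
     (if k = 0 then p * x 0 * x 2 + q * x 0 * (x 2)\<^sup>2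
      else if k = 1 then - (p * x 0 * x 2) else 0)"

text \<open>The first index selects the exponent, the second the direction of
  differentiation.\<close>

definition d\<theta> :: "nat \<Rightarrow> nat \<Rightarrow> (nat \<Rightarrow> real) \<Rightarrow> real" where
  "d\<theta> k i x =
     (if k = 0 then
        if i = 0 then p * x 2 + q * (x 2)\<^sup>2 else if i = 2 then p * x 0 + 2 * q * x 0 * x 2 else 0
      else if k = 1 then
        if i = 0 then - (p * x 2) else if i = 2 then - (p * x 0) else 0
      else 0)"

definition weight :: "nat \<Rightarrow> (nat \<Rightarrow> real) \<Rightarrow> real" where
  "weight k x = exp (2 * \<theta> k x)"

text \<open>\<open>shift 0\<close> is the global chart of the manifold, \<open>shift t\<close> flattens the hypersurface M_t.\<close>

definition shift :: "real \<Rightarrow> (nat \<Rightarrow> real) chart" where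
  "shift t = (Rn 3, \<lambda>x. x(2 := x 2 - t))"

text \<open>With a single chart in the atlas, a tangent vector is determined by its components in
  \<open>shift 0\<close>, so the norm may be read off there.\<close>

definition warped :: "(nat \<Rightarrow> real) finsler" where
  "warped = \<lparr>fdim = 3, fspace = Euclidean_space 3, atlas = {shift 0},
     fnorm = \<lambda>x v. sqrt (\<Sum>k<3. weight k x * (v (shift 0) k)\<^sup>2)\<rparr>"

lemma warped_sel [simp]:
  "fdim warped = 3" "fspace warped = Euclidean_space 3" "atlas warped = {shift 0}"
  "fnorm warped x v = sqrt (\<Sum>k<3. weight k x * (v (shift 0) k)\<^sup>2)"
  by (simp_all add: warped_def)

lemma cdom_shift [simp]: "cdom (shift t) = Rn 3"
  and cmap_shift: "cmap (shift t) = (\<lambda>x. x(2 := x 2 - t))"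
  and cmap_shift_0 [simp]: "cmap (shift 0) x = x"
  by (simp_all add: shift_def)

section \<open>Charts and the norm in coordinates\<close>

lemma crange_shift [simp]: "cmap (shift t) ` Rn 3 = Rn 3"
proof -
  have "x \<in> (\<lambda>x. x(2 := x 2 - t)) ` Rn 3" if "x \<in> Rn 3" for x
    using that by (intro image_eqI[of _ _ "x(2 := x 2 + t)"]) (auto simp: Rn_upd)
  then show ?thesis
    by (auto simp: cmap_shift Rn_upd)
qed

lemma cinv_shift: "x \<in> Rn 3 \<Longrightarrow> cinv (shift t) x = x(2 := x 2 + t)"
  unfolding cinv_def
  by (rule inv_into_f_eq) (auto simp: cmap_shift Rn_upd inj_on_def fun_eq_iff split: if_splits)

lemma cinv_shift_0 [simp]: "x \<in> Rn 3 \<Longrightarrow> cinv (shift 0) x = x"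
  by (simp add: cinv_shift)

lemma charts_at_warped [simp]: "x \<in> Rn 3 \<Longrightarrow> charts_at warped x = {shift 0}"
  by (auto simp: charts_at_def)

lemma push_shift_0:
  assumes "x \<in> Rn 3"
  shows "push warped x (shift 0) (shift 0) y = (\<lambda>i. if i < 3 then y i else 0)"
proof -
  have "pd j (\<lambda>x. cmap (shift 0) (cinv (shift 0) x) i) x = (if i = j then 1 else 0)"
    if "j < 3" for i j
  proof (rule pd_eqI)
    \<comment> \<open>\<open>cinv_shift_0\<close> gives the identity only on \<open>Rn 3\<close>, so
      the varied point has to be kept inside.\<close>
    have "(\<lambda>t. cmap (shift 0) (cinv (shift 0) (x(j := t))) i) = (\<lambda>t. (x(j := t)) i)"
      using Rn_upd[OF assms that] by simp
    then show "((\<lambda>t. cmap (shift 0) (cinv (shift 0) (x(j := t))) i)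
        has_real_derivative (if i = j then 1 else 0)) (at (x j))"
      by (auto intro!: derivative_eq_intros)
  qed
  then show ?thesis
    using assms by (auto simp: push_def fun_eq_iff sum_lessThan_3 less_3_cases)
qed

lemma Floc:
  "x \<in> Rn 3 \<Longrightarrow> Floc warped (shift 0) x y = sqrt (\<Sum>k<3. weight k x * (y k)\<^sup>2)"
  by (simp add: Floc_def vec_of_def push_shift_0)

lemma weight_pos [simp]: "weight k x > 0"
  by (simp add: weight_def)

lemma weight_neq_0 [simp]: "weight k x \<noteq> 0"
  using weight_pos[of k x] by linarith

lemma weight_2 [simp]: "weight 2 x = 1"
  by (simp add: weight_def \<theta>_def)

lemma Floc_square:
  "x \<in> Rn 3 \<Longrightarrow> (Floc warped (shift 0) x y)\<^sup>2 = (\<Sum>k<3. weight k x * (y k)\<^sup>2)"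
  by (simp add: Floc sum_nonneg less_imp_le)

section \<open>Derivatives of the squared norm, fundamental tensor and geodesic coefficients\<close>

lemma DERIV_\<theta>: "((\<lambda>t. \<theta> k (x(i := t))) has_real_derivative d\<theta> k i x) (at (x i))"
proof -
  consider "i = 0" | "i = 2" | "i \<noteq> 0" "i \<noteq> 2" by blast
  then show ?thesis
    by cases (auto simp: \<theta>_def d\<theta>_def intro!: derivative_eq_intros)
qed

lemma DERIV_weight:
  "((\<lambda>t. weight k (x(i := t))) has_real_derivative 2 * d\<theta> k i x * weight k x) (at (x i))"
  unfolding weight_def
  using DERIV_fun_exp[OF DERIV_cmult[OF DERIV_\<theta>, of 2]] by (simp add: mult_ac)

lemma pdy_Floc_square:
  assumes "x \<in> Rn 3" "l < 3"
  shows "pdy l (\<lambda>x y. (Floc warped (shift 0) x y)\<^sup>2) x y = 2 * weight l x * y l"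
  unfolding pdy_def Floc_square[OF assms(1)]
proof (rule pd_eqI)
  show "((\<lambda>t. \<Sum>k<3. weight k x * ((y(l := t)) k)\<^sup>2) has_real_derivative 2 * weight l x * y l) (at (y l))"
    using \<open>l < 3\<close> unfolding less_3_cases sum_lessThan_3
    by (auto intro!: derivative_eq_intros)
qed

lemma pdy_pdy_Floc_square:
  assumes "x \<in> Rn 3" "i < 3" "j < 3"
  shows "pdy j (pdy i (\<lambda>x y. (Floc warped (shift 0) x y)\<^sup>2)) x y = (if i = j then 2 * weight i x else 0)"
  unfolding pdy_def[of j] pdy_Floc_square[OF assms(1,2)]
  by (rule pd_eqI) (auto intro!: derivative_eq_intros)

lemma pdx_Floc_square:
  assumes "x \<in> Rn 3" "l < 3"
  shows "pdx l (\<lambda>x y. (Floc warped (shift 0) x y)\<^sup>2) x y =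
    (\<Sum>k<3. 2 * d\<theta> k l x * weight k x * (y k)\<^sup>2)"
  unfolding pdx_def
proof (rule pd_eqI)
  show "((\<lambda>t. (Floc warped (shift 0) (x(l := t)) y)\<^sup>2) has_real_derivative
      (\<Sum>k<3. 2 * d\<theta> k l x * weight k x * (y k)\<^sup>2)) (at (x l))"
    unfolding Floc_square[OF Rn_upd[OF assms]]
    by (intro DERIV_sum DERIV_cmult_right DERIV_weight)
qed

lemma pdx_pdy_Floc_square:
  assumes "x \<in> Rn 3" "l < 3" "k < 3"
  shows "pdx k (pdy l (\<lambda>x y. (Floc warped (shift 0) x y)\<^sup>2)) x y = 2 * (2 * d\<theta> l k x * weight l x) * y l"
  unfolding pdx_def
proof (rule pd_eqI)
  show "((\<lambda>t. pdy l (\<lambda>x y. (Floc warped (shift 0) x y)\<^sup>2) (x(k := t)) y) has_real_derivative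
      2 * (2 * d\<theta> l k x * weight l x) * y l) (at (x k))"
    unfolding pdy_Floc_square[OF Rn_upd[OF assms(1,3)] assms(2)]
    by (intro DERIV_cmult DERIV_cmult_right DERIV_weight)
qed

text \<open>The squared norm is a diagonal quadratic form in \<open>y\<close>, so the fundamental
  tensor is diagonal and independent of \<open>y\<close>: the metric is Riemannian.\<close>

lemma gmat:
  "x \<in> Rn 3 \<Longrightarrow>
    gmat warped (shift 0) x y = mat 3 3 (\<lambda>(i, j). if i = j then weight i x else 0)"
  by (rule eq_matI) (auto simp: gmat_def pdy_pdy_Floc_square)

lemma ginner:
  "x \<in> Rn 3 \<Longrightarrow> ginner warped (shift 0) x y u v = (\<Sum>k<3. weight k x * u k * v k)"
  by (simp add: ginner_def gmat sum_lessThan_3)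

lemma ginv:
  assumes "x \<in> Rn 3"
  shows "ginv warped (shift 0) x y = mat 3 3 (\<lambda>(i, j). if i = j then 1 / weight i x else 0)"
proof -
  have "mat 3 3 (\<lambda>(i, j). if i = j then weight i x else 0) *
      mat 3 3 (\<lambda>(i, j). if i = j then 1 / weight i x else 0) = 1\<^sub>m 3"
    by (rule eq_matI) (auto simp: scalar_prod_def sum_lessThan_3 less_3_cases lessThan_atLeast0[symmetric])
  then show ?thesis
    unfolding ginv_def gmat[OF assms] by (subst mat_inverse_eqI) auto
qed

text \<open>The diagonal inverse matrix leaves only the summand l = i, and each derivative of
  \<open>weight k\<close> is twice that of \<open>\<theta> k\<close> times \<open>weight k\<close>,
  so the weights survive only as quotients.\<close>

lemma Gcoef:
  assumes "x \<in> Rn 3" "i < 3"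
  shows "Gcoef warped (shift 0) i x y =
    y i * (\<Sum>k<3. d\<theta> i k x * y k) - 1/2 * (\<Sum>k<3. d\<theta> k i x * (weight k x / weight i x) * (y k)\<^sup>2)"
proof -
  have delta: "(\<Sum>l<3. (if i = l then a else 0) * f l) = a * f i" for a :: real and f
    using \<open>i < 3\<close> by (auto simp: less_3_cases sum_lessThan_3)
  have "Gcoef warped (shift 0) i x y = 1/4 * (\<Sum>l<3. (if i = l then 1 / weight i x else 0) *
      ((\<Sum>k<3. 2 * (2 * d\<theta> l k x * weight l x) * y l * y k) -
       (\<Sum>k<3. 2 * d\<theta> k l x * weight k x * (y k)\<^sup>2)))"
    using assms by (simp add: Gcoef_def ginv pdx_Floc_square pdx_pdy_Floc_square)
  also have "\<dots> = y i * (\<Sum>k<3. d\<theta> i k x * y k) -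
      1/2 * (\<Sum>k<3. d\<theta> k i x * (weight k x / weight i x) * (y k)\<^sup>2)"
    unfolding delta by (simp add: sum_lessThan_3 field_simps)
  finally show ?thesis .
qed

end

subsection \<open>The warped space is a Finsler manifold\<close>

lemma homeomorphic_map_shift:
  "homeomorphic_map (Euclidean_space 3) (Euclidean_space 3) (\<lambda>x. x(2 := x 2 - t))"
proof -
  have cont: "continuous_map (Euclidean_space 3) (Euclidean_space 3) (\<lambda>x. x(2 := x 2 - s))" for s
  proof -
    have "continuous_on (Rn 3) (\<lambda>x. (x(2 := x 2 - s)) i)" for i
      by (cases "i = 2") (auto intro!: continuous_intros continuous_on_subset[OF continuous_on_product_coordinates])
    then have "continuous_on (Rn 3) (\<lambda>x. x(2 := x 2 - s))"
      by (rule continuous_on_coordinatewise_then_product)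
    then show ?thesis
      using cm_Euclidean_space_iff_continuous_on[of 3 UNIV 3 "\<lambda>x. x(2 := x 2 - s)"]
      by (auto simp: Rn_upd)
  qed
  show ?thesis
    \<comment> \<open>The inverse is written as a shift by \<open>- t\<close>, so that
      \<open>cont\<close> covers both directions.\<close>
    by (rule homeomorphic_maps_imp_map[where g = "\<lambda>x. x(2 := x 2 - (- t))"])
      (use cont[of t] cont[of "- t"] in \<open>auto simp: homeomorphic_maps_def\<close>)
qed

lemma is_chart_shift: "is_chart 3 (Euclidean_space 3) (shift t)"
  using homeomorphic_map_shift[of t]
  unfolding is_chart_def cdom_shift crange_shift by (simp add: cmap_shift)

lemma smooth_transition_shift: "smooth_transition 3 (shift s) (shift t)"
  unfolding smooth_transition_def
proof (intro allI impI)
  fix i :: nat assume "i < 3"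
  have "smooth_fun 3 (Rn 3) (\<lambda>x. cmap (shift t) (cinv (shift s) x) i)"
    \<comment> \<open>Leaving \<open>shift s\<close> adds \<open>s\<close> to the last coordinate,
      entering \<open>shift t\<close> subtracts \<open>t\<close>.\<close>
    by (rule smooth_fun_elementary_Rn[where f = "\<lambda>x. x i + (if i = 2 then s - t else 0)"])
      (auto intro: elementary.intros simp: cinv_shift cmap_shift)
  then show "smooth_fun 3 (cmap (shift s) ` (cdom (shift s) \<inter> cdom (shift t)))
      (\<lambda>x. cmap (shift t) (cinv (shift s) x) i)"
    by simp
qed

lemma quadratic_form_pos:
  assumes "u k \<noteq> 0" "k < 3"
  shows "(\<Sum>k<3. weight p q k x * (u k)\<^sup>2) > 0"
  by (rule sum_pos2[of _ k]) (use assms in \<open>auto intro!: mult_nonneg_nonneg less_imp_le[OF weight_pos]\<close>)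

lemma Rn_nonzero_coord:
  assumes "u \<in> Rn n" "u \<noteq> (\<lambda>_. 0)"
  obtains k where "k < n" "u k \<noteq> 0"
  using assms by (auto simp: topspace_Euclidean_space fun_eq_iff) (metis not_le)

lemma elementary_\<theta>: "elementary S (\<theta> p q k)"
  unfolding \<theta>_def[abs_def] power2_eq_square
  \<comment> \<open>\<open>elementary\<close> has no rule for negation; it is obtained as
    multiplication by the constant -1.\<close>
  by (cases "k = 0"; cases "k = 1")
    (auto intro!: elementary.intros elementary.mult[OF elementary.const[of _ "-1"], simplified])

text \<open>Off the zero section the norm is the square root of a positive elementary function of
  the six coordinates, hence smooth. Positive definiteness is that of a diagonal form with positive
  weights.\<close>

lemma finsler_manifold_warped: "finsler_manifold (warped p q)"
proof -
  define S where "S = {z \<in> Rn 6. xpart 3 z \<in> Rn 3 \<and> ypart 3 z \<noteq> (\<lambda>_. 0)}"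
  define Q where "Q z = (\<Sum>k<3. exp (2 * \<theta> p q k z) * (z (3 + k) * z (3 + k)))" for z
  have S: "z \<in> S \<longleftrightarrow> z \<in> Rn 6 \<and> (\<exists>k<3. z (3 + k) \<noteq> 0)" for z
    by (auto simp: S_def topspace_Euclidean_space xpart_def ypart_def fun_eq_iff)
  \<comment> \<open>\<open>\<theta>\<close> reads only the coordinates 0 and 2, on which
    \<open>xpart 3 z\<close> and \<open>z\<close> agree.\<close>
  have \<theta>: "\<theta> p q k (xpart 3 z) = \<theta> p q k z" for k z
    by (simp add: \<theta>_def xpart_def)
  have Q: "(\<Sum>k<3. weight p q k (xpart 3 z) * (ypart 3 z k)\<^sup>2) = Q z" for z
    unfolding Q_def weight_def \<theta> by (simp add: sum_lessThan_3 ypart_def power2_eq_square)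
  have Q_pos: "Q z > 0" if "z \<in> S" for z
  proof -
    from that obtain k where "k < 3" "ypart 3 z k \<noteq> 0"
      by (auto simp: S ypart_def)
    then have "(\<Sum>k<3. weight p q k (xpart 3 z) * (ypart 3 z k)\<^sup>2) > 0"
      by (intro quadratic_form_pos)
    then show ?thesis
      by (simp only: Q)
  qed
  have "smooth_fun 6 S (\<lambda>z. Floc (warped p q) (shift 0) (xpart 3 z) (ypart 3 z))"
  proof (rule smooth_fun_elementary[where f = "\<lambda>z. Q z powr (1/2)"])
    show "\<forall>\<^sub>F t in nhds (z i). z(i := t) \<in> S" if "z \<in> S" "i < 6" for z i
    proof -
      from that obtain k where k: "k < 3" "z (3 + k) \<noteq> 0" and z: "z \<in> Rn 6"
        by (auto simp: S)
      \<comment> \<open>One nonzero coordinate of \<open>y\<close> is enough to stay off the zero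
        section, and it remains nonzero under small changes.\<close>
      have "\<forall>\<^sub>F t in nhds (z i). (z(i := t)) (3 + k) \<noteq> 0"
      proof (cases "i = 3 + k")
        case True
        with k show ?thesis
          by (auto intro!: t1_space_nhds)
      qed (use k in auto)
      then show ?thesis
        by (rule eventually_mono) (use k(1) Rn_upd[OF z that(2)] S in blast)
    qed
    have "elementary S Q"
      unfolding Q_def[abs_def] sum_lessThan_3 by (intro elementary.intros elementary_\<theta>)
    then show "elementary S (\<lambda>z. Q z powr (1/2))"
      using Q_pos by (rule elementary.powr)
    show "Floc (warped p q) (shift 0) (xpart 3 z) (ypart 3 z) = Q z powr (1/2)" if "z \<in> S" for z
      using that Q_pos[OF that] by (subst Floc) (auto simp: S_def Q powr_half_sqrt)
  qed
  moreover have "connected_smooth_manifold 3 (Euclidean_space 3) {shift 0}"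
    by (simp add: connected_smooth_manifold_def Hausdorff_Euclidean_space second_countable_Euclidean_space
        connected_Euclidean_space smooth_atlas_def is_chart_shift smooth_transition_shift)
  moreover have "Floc (warped p q) (shift 0) x (\<lambda>i. r * y i) = r * Floc (warped p q) (shift 0) x y"
    if "x \<in> Rn 3" "r > 0" for x y r
  proof -
    have "(\<Sum>k<3. weight p q k x * (r * y k)\<^sup>2) = r\<^sup>2 * (\<Sum>k<3. weight p q k x * (y k)\<^sup>2)"
      by (simp add: sum_distrib_left power_mult_distrib mult_ac)
    with that show ?thesis by (simp add: Floc real_sqrt_mult)
  qed
  moreover have "ginner (warped p q) (shift 0) x y u u > 0"
    if x: "x \<in> Rn 3" and u: "u \<in> Rn 3" "u \<noteq> (\<lambda>_. 0)" for x y u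
  proof -
    from Rn_nonzero_coord[OF u] obtain k where "k < 3" "u k \<noteq> 0" .
    from quadratic_form_pos[of u, OF this(2,1)] show ?thesis
      using x by (simp add: ginner power2_eq_square mult.assoc)
  qed
  moreover have "Floc (warped p q) (shift 0) x y \<ge> 0" if "x \<in> Rn 3" for x y
    using that by (simp add: Floc sum_nonneg less_imp_le)
  ultimately show ?thesis
    unfolding finsler_manifold_def S_def
    by (simp add: topspace_Euclidean_space)
qed

subsection \<open>Curvature\<close>

text \<open>Serves both as the components of d/dx^b and as a point of R^n.\<close>

definition coord_vec :: "nat \<Rightarrow> nat \<Rightarrow> real" where
  "coord_vec b = (\<lambda>i. if i = b then 1 else 0)"

lemma coord_vec_apply [simp]: "coord_vec b i = (if i = b then 1 else 0)"
  by (simp add: coord_vec_def)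

lemma coord_vec_Rn [simp]: "b < n \<Longrightarrow> coord_vec b \<in> Rn n"
  by (auto simp: topspace_Euclidean_space)

text \<open>The coefficient of (dx^2)^2 is constant and no coefficient depends on x^1.
  \<open>Suc 0\<close> is the form to which the simplifier brings the index 1.\<close>

lemma d\<theta>_2 [simp]: "d\<theta> p q 2 i x = 0" and d\<theta>_1 [simp]: "d\<theta> p q i (Suc 0) x = 0"
  by (simp_all add: d\<theta>_def)

text \<open>The x^2-lines are geodesics: in \<open>Gcoef\<close> at d/dx^2 every remaining term
  contains a derivative of \<open>\<theta> 2\<close>, which is 0.\<close>

lemma Gcoef_coord_vec_2:
  assumes "x \<in> Rn 3" "i < 3"
  shows "Gcoef (warped p q) (shift 0) i x (coord_vec 2) = 0"
  unfolding Gcoef[OF assms] using assms(2) by (auto simp: less_3_cases sum_lessThan_3)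

text \<open>Up to sign this diagonal matrix is going to be the shape operator of the slices.\<close>

lemma Ncoef_coord_vec_2:
  assumes "x \<in> Rn 3" "i < 3" "j < 3"
  shows "Ncoef (warped p q) (shift 0) i j x (coord_vec 2) = (if i = j then d\<theta> p q i 2 x else 0)"
  unfolding Ncoef_def pdy_def Gcoef[OF assms(1,2)]
  by (rule pd_eqI)
    (use assms(2,3) in \<open>auto simp: less_3_cases sum_lessThan_3 intro!: derivative_eq_intros\<close>)

text \<open>The geodesic coefficients vanish at d/dx^2 over every point, so the first and third
  terms of \<open>Riemann\<close> drop out. What remains is minus the x^2-derivative of N^0_0 and
  minus its square.\<close>

lemma Riemann_coord_vec_2:
  assumes "x \<in> Rn 3"
  shows "Riemann (warped p q) (shift 0) 0 0 x (coord_vec 2) =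
    - (2 * q * x 0 + (p * x 0 + 2 * q * x 0 * x 2)\<^sup>2)"
proof -
  have "pdx 0 (Gcoef (warped p q) (shift 0) 0) x (coord_vec 2) = 0"
    unfolding pdx_def by (rule pd_eqI) (simp add: Gcoef_coord_vec_2 Rn_upd assms)
  moreover have "pdx 2 (pdy 0 (Gcoef (warped p q) (shift 0) 0)) x (coord_vec 2) = 2 * q * x 0"
    unfolding pdx_def
  proof (rule pd_eqI)
    have "(\<lambda>t. pdy 0 (Gcoef (warped p q) (shift 0) 0) (x(2 := t)) (coord_vec 2)) =
        (\<lambda>t. p * x 0 + 2 * q * x 0 * t)"
      using Ncoef_coord_vec_2[of "x(2 := _)" 0 0] Rn_upd[OF assms]
      by (simp add: Ncoef_def d\<theta>_def)
    then show "((\<lambda>t. pdy 0 (Gcoef (warped p q) (shift 0) 0) (x(2 := t)) (coord_vec 2))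
        has_real_derivative 2 * q * x 0) (at (x 2))"
      by (auto intro!: derivative_eq_intros)
  qed
  ultimately show ?thesis
    using assms Ncoef_coord_vec_2[OF assms, unfolded Ncoef_def]
    by (simp add: Riemann_def Gcoef_coord_vec_2 sum_lessThan_3 d\<theta>_def power2_eq_square)
qed

text \<open>The two vectors are orthogonal and d/dx^2 has length 1, so numerator and denominator
  share the factor \<open>weight 0 x\<close> and the quotient is R^0_0.\<close>

lemma flag_curvature_coord_vec:
  assumes "x \<in> Rn 3"
  shows "flag_curvature (warped p q) (shift 0) x (coord_vec 2) (coord_vec 0) =
    - (2 * q * x 0 + (p * x 0 + 2 * q * x 0 * x 2)\<^sup>2)"
  using assms by (simp add: flag_curvature_def ginner sum_lessThan_3 Riemann_coord_vec_2)

text \<open>The flags spanned by d/dx^2 and d/dx^0 have curvature 0 at the origin and - (2 q + p^2)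
  at (1, 0, 0).\<close>

lemma not_constant_flag_curvature:
  assumes "2 * q + p\<^sup>2 \<noteq> 0"
  shows "\<not> constant_flag_curvature (warped p q)"
proof
  assume "constant_flag_curvature (warped p q)"
  then obtain \<kappa> where \<kappa>: "\<And>x y V. x \<in> Rn 3 \<Longrightarrow> y \<in> Rn 3 \<Longrightarrow> V \<in> Rn 3 \<Longrightarrow> y \<noteq> (\<lambda>_. 0) \<Longrightarrow>
      \<forall>r. V \<noteq> (\<lambda>i. r * y i) \<Longrightarrow> flag_curvature (warped p q) (shift 0) x y V = \<kappa>"
    by (auto simp: constant_flag_curvature_def)
  have "flag_curvature (warped p q) (shift 0) x (coord_vec 2) (coord_vec 0) = \<kappa>" if "x \<in> Rn 3" for x
  proof (rule \<kappa>)
    show "coord_vec 2 \<noteq> (\<lambda>_. 0)"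
      by (auto simp: coord_vec_def fun_eq_iff)
    show "\<forall>r. coord_vec 0 \<noteq> (\<lambda>i. r * coord_vec 2 i)"
      by (auto simp: fun_eq_iff intro!: exI[of _ 0])
  qed (use that in auto)
  note this[of "coord_vec 0"] this[of "\<lambda>_. 0"]
  then show False
    using assms by (simp add: flag_curvature_coord_vec topspace_Euclidean_space)
qed


section \<open>The hypersurfaces\<close>

definition slice :: "real \<Rightarrow> (nat \<Rightarrow> real) set" where
  "slice t = {x \<in> Rn 3. x 2 = t}"

text \<open>Independent of the base point: in a one-chart atlas the same object is the vector with
  components \<open>v\<close> at every point, with the conventional value 0 at all other
  charts.\<close>

definition const_vec :: "(nat \<Rightarrow> real) \<Rightarrow> (nat \<Rightarrow> real) tvec" where
  "const_vec v = (\<lambda>c i. if c = shift 0 then v i else 0)"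

lemma const_vec_shift [simp]: "const_vec v (shift 0) = v"
  by (simp add: const_vec_def)

section \<open>Curves and tangent spaces of the slices\<close>

lemma velocity_warped:
  "\<sigma> s \<in> Rn 3 \<Longrightarrow>
    velocity (warped p q) \<sigma> s = const_vec (\<lambda>i. if i < 3 then deriv (\<lambda>s. \<sigma> s i) s else 0)"
  by (auto simp: velocity_def const_vec_def fun_eq_iff)

lemma higher_deriv_affine:
  "(deriv ^^ k) (\<lambda>s. a + s * b :: real) =
    (if k = 0 then (\<lambda>s. a + s * b) else if k = 1 then (\<lambda>_. b) else (\<lambda>_. 0))"
proof (induction k)
  case (Suc k)
  have "deriv (\<lambda>s. a + s * b) = (\<lambda>_. b)"
    by (intro ext DERIV_imp_deriv) (auto intro!: derivative_eq_intros)
  then show ?case using Suc by auto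
qed auto

text \<open>Straight coordinate lines realise all tangent vectors of a slice and, in the direction
  \<open>coord_vec 2\<close>, are the normal geodesics.\<close>

lemma
  assumes x: "x \<in> Rn 3" and v: "v \<in> Rn 3"
  shows smooth_curve_line: "smooth_curve (warped p q) J (\<lambda>s i. x i + s * v i)"
    and velocity_line: "velocity (warped p q) (\<lambda>s i. x i + s * v i) s = const_vec v"
proof -
  have line: "(\<lambda>i. x i + s * v i) \<in> Rn 3" for s
    using x v by (auto simp: topspace_Euclidean_space)
  have "continuous_on J (\<lambda>s i. x i + s * v i)"
    by (intro continuous_on_coordinatewise_then_product continuous_intros)
  with line have "continuous_map (top_of_set J) (Euclidean_space 3) (\<lambda>s i. x i + s * v i)"
    by (auto simp: Euclidean_space_def euclidean_product_topology continuous_map_in_subtopology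
        topspace_Euclidean_space)
  with line show "smooth_curve (warped p q) J (\<lambda>s i. x i + s * v i)"
    by (auto simp: smooth_curve_def higher_deriv_affine)
  show "velocity (warped p q) (\<lambda>s i. x i + s * v i) s = const_vec v"
    using higher_deriv_affine[of 1] v
    by (auto simp: velocity_warped[of "\<lambda>s i. x i + s * v i", OF line] const_vec_def fun_eq_iff topspace_Euclidean_space)
qed

text \<open>A curve in the slice has constant last coordinate near 0, so its velocity has no
  component there; conversely, the straight line in such a direction stays in the slice.\<close>

lemma tangent_slice:
  assumes "x \<in> slice t"
  shows "tangent_of (warped p q) (slice t) x = const_vec ` {v \<in> Rn 3. v 2 = 0}"
proof (intro subset_antisym subsetI)
  fix X assume "X \<in> tangent_of (warped p q) (slice t) x"
  then obtain \<sigma> \<delta> where \<sigma>: "\<sigma> 0 = x" "\<delta> > 0" "\<sigma> ` {-\<delta><..<\<delta>} \<subseteq> slice t"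
    and X: "X = velocity (warped p q) \<sigma> 0"
    by (auto simp: tangent_of_def curves_in_def)
  have "\<forall>\<^sub>F s in nhds 0. \<sigma> s 2 = t"
    using eventually_nhds_in_open[of "{-\<delta><..<\<delta>}" 0] \<sigma>(2,3)
    by (auto simp: slice_def image_subset_iff elim!: eventually_mono)
  then have "deriv (\<lambda>s. \<sigma> s 2) 0 = deriv (\<lambda>s. t) 0"
    by (intro deriv_cong_ev) auto
  then have "deriv (\<lambda>s. \<sigma> s 2) 0 = 0"
    by simp
  moreover have "X = const_vec (\<lambda>i. if i < 3 then deriv (\<lambda>s. \<sigma> s i) 0 else 0)"
    using assms \<sigma>(1) by (simp add: X velocity_warped slice_def)
  ultimately show "X \<in> const_vec ` {v \<in> Rn 3. v 2 = 0}"
    by (auto simp: topspace_Euclidean_space)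
next
  fix X assume "X \<in> const_vec ` {v \<in> Rn 3. v 2 = 0}"
  then obtain v where v: "v \<in> Rn 3" "v 2 = 0" and X: "X = const_vec v"
    by auto
  have "(\<lambda>s i. x i + s * v i) \<in> curves_in (warped p q) (slice t) x"
    unfolding curves_in_def
    using assms v by (auto simp: slice_def smooth_curve_line topspace_Euclidean_space intro!: exI[of _ 1])
  moreover have "velocity (warped p q) (\<lambda>s i. x i + s * v i) 0 = X"
    using assms v X by (simp add: velocity_line slice_def)
  ultimately show "X \<in> tangent_of (warped p q) (slice t) x"
    unfolding tangent_of_def by blast
qed

text \<open>\<open>shift t\<close> flattens the slice and is smoothly compatible with the atlas. The
  field is prescribed on the slice only, so that the lemma also applies to
  \<open>parallel_normal\<close>, whose values elsewhere are not determined.\<close>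

lemma hypersurface_with_normal_slice:
  assumes \<nu>: "\<And>x. x \<in> slice t \<Longrightarrow> \<nu> x = const_vec (coord_vec 2)"
  shows "hypersurface_with_normal (warped p q) (slice t) \<nu>"
proof -
  have "\<exists>c. is_chart 3 (Euclidean_space 3) c \<and>
        (smooth_transition 3 c (shift 0) \<and> smooth_transition 3 (shift 0) c) \<and>
        x \<in> cdom c \<and> cmap c ` (slice t \<inter> cdom c) = {x \<in> crange c. x 2 = 0}"
    if "x \<in> slice t" for x
  proof (intro exI[of _ "shift t"] conjI)
    have "{x \<in> Rn 3. x 2 = 0} \<subseteq> cmap (shift t) ` (slice t \<inter> Rn 3)"
    proof
      fix y assume "y \<in> {x \<in> Rn 3. x 2 = 0}"
      then show "y \<in> cmap (shift t) ` (slice t \<inter> Rn 3)"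
        by (intro image_eqI[of _ _ "y(2 := t)"]) (auto simp: slice_def cmap_shift Rn_upd fun_eq_iff)
    qed
    moreover have "cmap (shift t) ` (slice t \<inter> Rn 3) \<subseteq> {x \<in> Rn 3. x 2 = 0}"
      by (auto simp: slice_def cmap_shift Rn_upd)
    ultimately show "cmap (shift t) ` (slice t \<inter> cdom (shift t)) = {x \<in> crange (shift t). x 2 = 0}"
      by simp
  qed (use that in \<open>auto simp: is_chart_shift smooth_transition_shift slice_def\<close>)
  then have "embedded_hypersurface (warped p q) (slice t)"
    by (auto simp: embedded_hypersurface_def slice_def)
  moreover have "smooth_field_along (warped p q) (slice t) \<nu>"
    unfolding smooth_field_along_def
  proof (intro ballI conjI allI impI)
    fix x assume x: "x \<in> slice t"
    then have x3: "x \<in> Rn 3" by (simp add: slice_def)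
    have "push (warped p q) x (shift 0) (shift 0) (coord_vec 2) = coord_vec 2"
      by (auto simp: push_shift_0[OF x3])
    then show "\<nu> x \<in> tangent_space (warped p q) x"
      using x3 by (simp add: \<nu>[OF x] tangent_space_def) (simp add: const_vec_def)
    fix c i assume "c \<in> charts_at (warped p q) x" "i < fdim (warped p q)"
    with x3 have c: "c = shift 0" by simp
    have "smooth_fun 3 (Rn 3) (\<lambda>_. coord_vec 2 i)"
      by (rule smooth_fun_elementary_Rn[OF elementary.const refl])
    with c x3 show "\<exists>W f. openin (fspace (warped p q)) W \<and> x \<in> W \<and> W \<subseteq> cdom c \<and>
        smooth_fun (fdim (warped p q)) (cmap c ` W) f \<and>
        (\<forall>y\<in>slice t \<inter> W. \<nu> y c i = f (cmap c y))"
      by (intro exI[of _ "Rn 3"] exI[of _ "\<lambda>_. coord_vec 2 i"]) (auto simp: \<nu>)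
  qed
  moreover have "fnorm (warped p q) x (\<nu> x) = 1" if "x \<in> slice t" for x
    using \<nu>[OF that] by (simp add: sum_lessThan_3)
  moreover have "ginner (warped p q) (shift 0) x (\<nu> x (shift 0)) (\<nu> x (shift 0)) (X (shift 0)) = 0"
    if "x \<in> slice t" "X \<in> tangent_of (warped p q) (slice t) x" for x X
  proof -
    have "X (shift 0) 2 = 0"
      using that(2) unfolding tangent_slice[OF that(1)] by auto
    moreover have "x \<in> Rn 3"
      using that(1) by (simp add: slice_def)
    ultimately show ?thesis
      by (simp add: \<nu>[OF that(1)] ginner sum_lessThan_3)
  qed
  ultimately show ?thesis
    unfolding hypersurface_with_normal_def unit_normal_field_def
    by (auto simp: slice_def)
qed

text \<open>The components of the normal are constant on the slice, so only the connection term
  contributes, and it is diagonal.\<close>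

lemma shape_operator_slice:
  assumes x: "x \<in> slice t" and \<nu>: "\<And>x. x \<in> slice t \<Longrightarrow> \<nu> x = const_vec (coord_vec 2)"
    and v: "v \<in> Rn 3" "v 2 = 0"
  shows "shape_operator (warped p q) (slice t) \<nu> x (const_vec v) =
    const_vec (\<lambda>i. if i < 3 then - d\<theta> p q i 2 x * v i else 0)"
proof -
  have x3: "x \<in> Rn 3" using x by (simp add: slice_def)
  have "dir_deriv (warped p q) (slice t) x (const_vec v) (\<lambda>y. \<nu> y (shift 0) i) = 0" for i
    unfolding dir_deriv_def
  proof (rule the_equality)
    show *: "\<forall>\<sigma>\<in>curves_in (warped p q) (slice t) x. velocity (warped p q) \<sigma> 0 = const_vec v \<longrightarrow>
        ((\<lambda>s. \<nu> (\<sigma> s) (shift 0) i) has_real_derivative 0) (at 0)"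
    proof (intro ballI impI)
      fix \<sigma> assume "\<sigma> \<in> curves_in (warped p q) (slice t) x"
      then obtain \<delta> where \<sigma>: "\<delta> > 0" "\<sigma> ` {-\<delta><..<\<delta>} \<subseteq> slice t"
        by (auto simp: curves_in_def)
      have "\<forall>\<^sub>F s in nhds 0. \<nu> (\<sigma> s) (shift 0) i = coord_vec 2 i"
        using eventually_nhds_in_open[of "{-\<delta><..<\<delta>}" 0] \<sigma>
        by (auto simp: \<nu> image_subset_iff elim!: eventually_mono)
      then show "((\<lambda>s. \<nu> (\<sigma> s) (shift 0) i) has_real_derivative 0) (at 0)"
        using DERIV_cong_ev[OF refl _ refl, of "\<lambda>s. \<nu> (\<sigma> s) (shift 0) i" "\<lambda>_. coord_vec 2 i"] by simp
    qed
    \<comment> \<open>Uniqueness of the directional derivative requires an actual curve with this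
      velocity; otherwise every \<open>D\<close> would satisfy the condition vacuously.\<close>
    have "const_vec v \<in> tangent_of (warped p q) (slice t) x"
      using v by (auto simp: tangent_slice[OF x])
    then obtain \<sigma> where \<sigma>: "\<sigma> \<in> curves_in (warped p q) (slice t) x" "velocity (warped p q) \<sigma> 0 = const_vec v"
      by (auto simp: tangent_of_def)
    fix D assume "\<forall>\<sigma>\<in>curves_in (warped p q) (slice t) x. velocity (warped p q) \<sigma> 0 = const_vec v \<longrightarrow>
        ((\<lambda>s. \<nu> (\<sigma> s) (shift 0) i) has_real_derivative D) (at 0)"
    with * \<sigma> show "D = 0"
      by (meson DERIV_unique)
  qed
  note dir_deriv = this
  show ?thesis
  proof (intro ext)
    fix c i
    show "shape_operator (warped p q) (slice t) \<nu> x (const_vec v) c i =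
      const_vec (\<lambda>i. if i < 3 then - d\<theta> p q i 2 x * v i else 0) c i"
    proof (cases "c = shift 0")
      case True
      then show ?thesis
        using x3 v by (auto simp: shape_operator_def dir_deriv \<nu>[OF x] Ncoef_coord_vec_2 sum_lessThan_3 less_3_cases)
    next
      case False
      then show ?thesis
        using x3 by (simp add: shape_operator_def const_vec_def)
    qed
  qed
qed

section \<open>Principal curvatures of the slices\<close>

lemma lincomb_const_vec: "lincomb_tvec m a (\<lambda>b. const_vec (u b)) = const_vec (\<lambda>i. \<Sum>b<m. a b * u b i)"
  by (auto simp: lincomb_tvec_def const_vec_def fun_eq_iff)

lemma const_vec_inject [simp]: "const_vec u = const_vec v \<longleftrightarrow> u = v"
  using const_vec_shift by metis

text \<open>The coordinate frame yields the diagonal matrix \<open>D\<close>. The matrix in any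
  other basis is similar to \<open>D\<close>, so it has the same characteristic polynomial and the
  description is unique.\<close>

lemma principal_curvatures_slice:
  assumes x: "x \<in> slice t" and \<nu>: "\<And>x. x \<in> slice t \<Longrightarrow> \<nu> x = const_vec (coord_vec 2)"
  shows "principal_curvatures (warped p q) (slice t) \<nu> x = {#- d\<theta> p q 0 2 x, - d\<theta> p q 1 2 x#}"
proof -
  let ?T = "tangent_of (warped p q) (slice t) x"
  let ?A = "shape_operator (warped p q) (slice t) \<nu> x"
  note T = tangent_slice[OF x]
  define D where "D = mat 2 2 (\<lambda>(i, j). if i = j then - d\<theta> p q i 2 x else 0)"
  have D: "D \<in> carrier_mat 2 2" by (simp add: D_def)
  have sum2: "(\<Sum>b<2. f b) = f 0 + f 1" for f :: "nat \<Rightarrow> real"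
    by (simp add: numeral_2_eq_2)
  have less2: "i < 2 \<longleftrightarrow> i = 0 \<or> i = 1" for i :: nat by auto
  have "char_poly D = [:- (- d\<theta> p q 0 2 x), 1:] * [:- (- d\<theta> p q 1 2 x), 1:]"
    by (subst char_poly_upper_triangular[OF D]) (auto simp: D_def diag_mat_def upt_rec numeral_2_eq_2)
  \<comment> \<open>The linear factors stay unexpanded so that \<open>proots_mult\<close> can
    separate their roots.\<close>
  then have proots_D: "proots (char_poly D) = {#- d\<theta> p q 0 2 x, - d\<theta> p q 1 2 x#}"
    by (simp only:) (subst proots_mult, auto simp del: mult_pCons_left mult_pCons_right)
  have A: "?A (const_vec v) = const_vec (\<lambda>i. if i < 3 then - d\<theta> p q i 2 x * v i else 0)"
    if "v \<in> Rn 3" "v 2 = 0" for v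
    using shape_operator_slice[OF x \<nu> that] .
  have coord_vec_T: "const_vec (coord_vec b) \<in> ?T" if "b < 2" for b
    using that by (auto simp: T)
  show ?thesis
    unfolding principal_curvatures_def
  proof (rule the_equality)
    have "basis_of ?T 2 (\<lambda>b. const_vec (coord_vec b))"
      unfolding basis_of_def lincomb_const_vec
    proof (intro conjI allI impI ballI)
      fix X assume "X \<in> ?T"
      then obtain v where v: "v \<in> Rn 3" "v 2 = 0" and X: "X = const_vec v" by (auto simp: T)
      have comb: "(\<lambda>i. \<Sum>b<2. a b * coord_vec b i) = (\<lambda>i. if i < 2 then a i else 0)" for a
        by (auto simp: fun_eq_iff sum2 less2)
      show "\<exists>!a. a \<in> Rn 2 \<and> X = const_vec (\<lambda>i. \<Sum>b<2. a b * coord_vec b i)"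
      proof (rule ex1I)
        \<comment> \<open>As \<open>v 2 = 0\<close>, the components of \<open>X\<close> lie in
          \<open>Rn 2\<close> and are themselves the coefficients.\<close>
        have "v i = 0" if "\<not> i < 2" for i
          using v that by (cases "i = 2") (auto simp: topspace_Euclidean_space)
        then have "v \<in> Rn 2" "(\<lambda>i. if i < 2 then v i else 0) = v"
          by (auto simp: topspace_Euclidean_space)
        then show "v \<in> Rn 2 \<and> X = const_vec (\<lambda>i. \<Sum>b<2. v b * coord_vec b i)"
          by (simp only: X comb)
        fix a assume "a \<in> Rn 2 \<and> X = const_vec (\<lambda>i. \<Sum>b<2. a b * coord_vec b i)"
        then have "a \<in> Rn 2" "v = (\<lambda>i. if i < 2 then a i else 0)"
          by (simp_all only: X comb const_vec_inject)
        then show "a = v"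
          by (auto simp: topspace_Euclidean_space)
      qed
    qed (rule coord_vec_T)
    moreover have "?A (const_vec (coord_vec b)) = lincomb_tvec 2 (\<lambda>a. D $$ (a, b)) (\<lambda>b. const_vec (coord_vec b))" if "b < 2" for b
      using that unfolding lincomb_const_vec
      by (subst A) (auto simp: less2 sum2 D_def)
    ultimately show "\<exists>e B. basis_of ?T (fdim (warped p q) - 1) e \<and>
        B \<in> carrier_mat (fdim (warped p q) - 1) (fdim (warped p q) - 1) \<and>
        (\<forall>b<fdim (warped p q) - 1. ?A (e b) = lincomb_tvec (fdim (warped p q) - 1) (\<lambda>a. B $$ (a, b)) e) \<and>
        {#- d\<theta> p q 0 2 x, - d\<theta> p q 1 2 x#} = proots (char_poly B)"
      using D proots_D by (intro exI[of _ "\<lambda>b. const_vec (coord_vec b)"] exI[of _ D]) simp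
  next
    fix P assume "\<exists>e B. basis_of ?T (fdim (warped p q) - 1) e \<and>
        B \<in> carrier_mat (fdim (warped p q) - 1) (fdim (warped p q) - 1) \<and>
        (\<forall>b<fdim (warped p q) - 1. ?A (e b) = lincomb_tvec (fdim (warped p q) - 1) (\<lambda>a. B $$ (a, b)) e) \<and>
        P = proots (char_poly B)"
    then obtain e B where e: "basis_of ?T 2 e" and B: "B \<in> carrier_mat 2 2"
      and AB: "\<And>b. b < 2 \<Longrightarrow> ?A (e b) = lincomb_tvec 2 (\<lambda>a. B $$ (a, b)) e"
      and P: "P = proots (char_poly B)" by auto
    define u where "u b = e b (shift 0)" for b
    have eu: "e b = const_vec (u b)" "u b \<in> Rn 3" "u b 2 = 0" if "b < 2" for b
      using e that by (auto simp: basis_of_def T u_def)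
    have lincomb: "lincomb_tvec 2 a e = const_vec (\<lambda>i. \<Sum>b<2. a b * u b i)" for a
      unfolding lincomb_const_vec[symmetric] by (simp add: lincomb_tvec_def eu)
    \<comment> \<open>Change of basis: column b holds the components of \<open>e b\<close>; two rows
      suffice because the third component vanishes.\<close>
    define U where "U = mat 2 2 (\<lambda>(i, b). u b i)"
    have U: "U \<in> carrier_mat 2 2" by (simp add: U_def)
    have "\<exists>a. const_vec (coord_vec j) = lincomb_tvec 2 a e" if "j < 2" for j
      using e coord_vec_T[OF that] unfolding basis_of_def by blast
    then obtain c where c: "\<And>j. j < 2 \<Longrightarrow> const_vec (coord_vec j) = lincomb_tvec 2 (c j) e"
      by metis
    \<comment> \<open>The coefficients of the coordinate vectors in the basis \<open>e\<close> form
      the inverse of \<open>U\<close>.\<close>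
    define W where "W = mat 2 2 (\<lambda>(b, j). c j b)"
    have W: "W \<in> carrier_mat 2 2" by (simp add: W_def)
    have UW: "U * W = 1\<^sub>m 2"
    proof (rule eq_matI)
      fix i j :: nat assume "i < dim_row (1\<^sub>m 2)" "j < dim_col (1\<^sub>m 2)"
      then have ij: "i < 2" "j < 2" by auto
      have "coord_vec j i = (\<Sum>b<2. c j b * u b i)"
        using c[OF ij(2)] unfolding lincomb by (metis const_vec_inject)
      then show "(U * W) $$ (i, j) = 1\<^sub>m 2 $$ (i, j)"
        using ij by (simp add: U_def W_def scalar_prod_def lessThan_atLeast0[symmetric] mult.commute)
    qed (auto simp: U_def W_def)
    have WU: "W * U = 1\<^sub>m 2" by (rule mat_mult_left_right_inverse[OF U W UW])
    \<comment> \<open>Both sides hold the components of the shape operator applied to the vectors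
      \<open>e b\<close>.\<close>
    have DU: "D * U = U * B"
    proof (rule eq_matI)
      fix i b assume "i < dim_row (U * B)" "b < dim_col (U * B)"
      then have ib: "i < 2" "b < 2" using U B by auto
      have "const_vec (\<lambda>i. if i < 3 then - d\<theta> p q i 2 x * u b i else 0) = const_vec (\<lambda>i. \<Sum>a<2. B $$ (a, b) * u a i)"
        using AB[OF ib(2)] unfolding lincomb by (simp add: eu[OF ib(2)] A)
      then have "- d\<theta> p q i 2 x * u b i = (\<Sum>a<2. B $$ (a, b) * u a i)"
        using ib by (auto dest: fun_cong[of _ _ i])
      then show "(D * U) $$ (i, b) = (U * B) $$ (i, b)"
        using ib B
        by (auto simp: D_def U_def scalar_prod_def lessThan_atLeast0[symmetric] sum2 less2 mult.commute)
    qed (use U B D in auto)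
    have "B = (W * U) * B" using B by (simp add: WU)
    also have "\<dots> = W * (D * U)" unfolding DU using W U B by (rule assoc_mult_mat)
    also have "\<dots> = W * D * U" using assoc_mult_mat[OF W D U] by simp
    finally have "similar_mat B D"
      using B D W U WU UW by (intro similar_matI[of B D W U 2]) auto
    then show "P = {#- d\<theta> p q 0 2 x, - d\<theta> p q 1 2 x#}"
      by (simp add: P char_poly_similar proots_D)
  qed
qed


section \<open>Normal geodesics and parallel hypersurfaces\<close>

abbreviation vertical :: "(nat \<Rightarrow> real) \<Rightarrow> (nat \<Rightarrow> real) tvec" where
  "vertical \<equiv> \<lambda>_. const_vec (coord_vec 2)"

text \<open>Both summands of the geodesic equation vanish, and \<open>weight 2\<close> being 1 gives
  unit speed.\<close>

lemma unit_speed_geodesic_line: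
  assumes x: "x \<in> Rn 3"
  shows "unit_speed_geodesic (warped p q) J (\<lambda>s i. x i + s * coord_vec 2 i)"
proof -
  have "(\<lambda>i. x i + s * coord_vec 2 i) \<in> Rn 3" for s
    using x by (auto simp: topspace_Euclidean_space)
  then show ?thesis
    using smooth_curve_line[OF x, of "coord_vec 2" p q J] velocity_line[OF x, of "coord_vec 2" p q]
    by (simp add: unit_speed_geodesic_def sum_lessThan_3 higher_deriv_affine[of 2] Gcoef_coord_vec_2 del: coord_vec_apply)
      (simp add: higher_deriv_affine[of 2])
qed

lemma line_normal_geodesic:
  assumes "x \<in> slice 0"
  shows "(\<lambda>s i. x i + s * coord_vec 2 i) \<in> normal_geodesics (warped p q) (slice 0) vertical t"
proof -
  have "x \<in> Rn 3" using assms by (simp add: slice_def)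
  then have "velocity (warped p q) (\<lambda>s i. x i + s * coord_vec 2 i) 0 = const_vec (coord_vec 2)"
    "unit_speed_geodesic (warped p q) {-1<..<\<bar>t\<bar> + 1} (\<lambda>s i. x i + s * coord_vec 2 i)"
    by (auto intro: velocity_line unit_speed_geodesic_line simp del: coord_vec_apply)
  then show ?thesis
    using assms unfolding normal_geodesics_def
    by (intro CollectI conjI exI[of _ "-1"] exI[of _ "\<bar>t\<bar> + 1"]) auto
qed

text \<open>
  In the order 1, 0, 2, the geodesic equation for each velocity component minus its initial value
  is a homogeneous linear equation once the earlier components are known, so nothing but the
  coordinate line solves it.
\<close>

lemma normal_geodesic_eq_line:
  assumes \<gamma>: "\<gamma> \<in> normal_geodesics (warped p q) (slice 0) vertical t" and "t > 0"
  shows "\<gamma> t = (\<lambda>i. \<gamma> 0 i + t * coord_vec 2 i)" and "velocity (warped p q) \<gamma> t = const_vec (coord_vec 2)"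
proof -
  obtain a b where ab: "a < 0" "t < b" and \<gamma>_geod: "unit_speed_geodesic (warped p q) {a<..<b} \<gamma>"
    using \<gamma> unfolding normal_geodesics_def by blast
  then have smooth: "smooth_curve (warped p q) {a<..<b} \<gamma>"
    by (simp only: unit_speed_geodesic_def)
  have geod: "(deriv ^^ 2) (\<lambda>s. cmap c (\<gamma> s) i) s
      + 2 * Gcoef (warped p q) c i (cmap c (\<gamma> s)) (velocity (warped p q) \<gamma> s c) = 0"
    if "s \<in> {a<..<b}" "c \<in> charts_at (warped p q) (\<gamma> s)" "i < 3" for s c i
    using \<gamma>_geod that unfolding unit_speed_geodesic_def by simp
  have J: "s \<in> {a<..<b}" if "s \<in> {0..t}" for s using that ab by auto
  have Rn: "\<gamma> s \<in> Rn 3" if "s \<in> {0..t}" for s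
    using smooth J[OF that] continuous_map_image_subset_topspace
    by (fastforce simp: smooth_curve_def)
  define D where "D i s = deriv (\<lambda>s. \<gamma> s i) s" for i s
  have diff: "(deriv ^^ k) (\<lambda>s. \<gamma> s i) differentiable at s" if "s \<in> {0..t}" "i < 3" for s i k
  proof -
    have "\<forall>c\<in>charts_at (warped p q) (\<gamma> s). \<forall>i<fdim (warped p q). \<forall>k.
        (deriv ^^ k) (\<lambda>s. cmap c (\<gamma> s) i) differentiable at s"
      using smooth J[OF that(1)] unfolding smooth_curve_def by blast
    then show ?thesis
      using Rn[OF that(1)] that(2) by simp
  qed
  have \<gamma>': "((\<lambda>s. \<gamma> s i) has_real_derivative D i s) (at s)" if "s \<in> {0..t}" "i < 3" for s i
    using diff[OF that, of 0] unfolding D_def by (simp add: DERIV_deriv_iff_real_differentiable)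
  have velocity: "velocity (warped p q) \<gamma> s = const_vec (\<lambda>i. if i < 3 then D i s else 0)"
    if "s \<in> {0..t}" for s
    unfolding D_def by (rule velocity_warped) (rule Rn[OF that])
  define G where "G i s = Gcoef (warped p q) (shift 0) i (\<gamma> s) (\<lambda>i. if i < 3 then D i s else 0)" for i s
  have D': "(D i has_real_derivative - 2 * G i s) (at s)" if "s \<in> {0..t}" "i < 3" for s i
  proof -
    have "(D i has_real_derivative deriv (D i) s) (at s)"
      using diff[OF that, of 1] unfolding D_def[abs_def] by (simp add: DERIV_deriv_iff_real_differentiable)
    moreover have "deriv (D i) s = - 2 * G i s"
      using geod[OF J[OF that(1)], of "shift 0" i] Rn[OF that(1)] that(2) velocity[OF that(1)]
      by (simp add: D_def[abs_def] G_def numeral_2_eq_2)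
    ultimately show ?thesis by simp
  qed
  have cont_\<gamma>: "continuous_on {0..t} (\<lambda>s. \<gamma> s i)" if "i < 3" for i
    using \<gamma>'[OF _ that] by (intro DERIV_continuous_on) (blast intro: has_field_derivative_at_within)
  have cont_D: "continuous_on {0..t} (D i)" if "i < 3" for i
    using D'[OF _ that] by (intro DERIV_continuous_on) (blast intro: has_field_derivative_at_within)
  have cont_d\<theta>: "continuous_on {0..t} (\<lambda>s. d\<theta> p q k i (\<gamma> s))" for k i
  proof -
    have "continuous_on {0..t} (\<lambda>s. \<gamma> s 0)" "continuous_on {0..t} (\<lambda>s. \<gamma> s 2)"
      using cont_\<gamma> by auto
    then show ?thesis
      by (cases "k = 0"; cases "k = 1"; cases "i = 0"; cases "i = 2")
        (simp_all add: d\<theta>_def continuous_on_add continuous_on_mult continuous_on_power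
          continuous_on_minus)
  qed
  have D_0: "D i 0 = coord_vec 2 i" if "i < 3" for i
  proof -
    have "velocity (warped p q) \<gamma> 0 = const_vec (coord_vec 2)"
      using \<gamma> unfolding normal_geodesics_def by blast
    then have "(\<lambda>i. if i < 3 then D i 0 else 0) = coord_vec 2"
      using velocity[of 0] \<open>t > 0\<close> by simp
    from fun_cong[OF this, of i] that show ?thesis by simp
  qed
  have D_1: "D 1 s = 0" if "s \<in> {0..t}" for s
  \<comment> \<open>No metric coefficient depends on x^1, so \<open>G 1\<close> is a multiple of
    \<open>D 1\<close>.\<close>
  proof (rule linear_ode_zero[OF _ _ _ that])
    show "(D 1 has_real_derivative
        - 2 * (d\<theta> p q 1 0 (\<gamma> s) * D 0 s + d\<theta> p q 1 2 (\<gamma> s) * D 2 s) * D 1 s) (at s)"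
      if "s \<in> {0..t}" for s
      using D'[OF that, of 1] Rn[OF that] by (simp add: G_def Gcoef sum_lessThan_3 mult_ac)
  qed (auto intro!: continuous_intros cont_D cont_d\<theta> simp: D_0[of 1, simplified])
  have D_00: "D 0 s = 0" if "s \<in> {0..t}" for s
  \<comment> \<open>The term of \<open>G 0\<close> quadratic in \<open>D 1\<close> is gone; the
    others contain the factor \<open>D 0\<close>.\<close>
  proof (rule linear_ode_zero[OF _ _ _ that])
    show "(D 0 has_real_derivative
        (- d\<theta> p q 0 0 (\<gamma> s) * D 0 s - 2 * d\<theta> p q 0 2 (\<gamma> s) * D 2 s) * D 0 s) (at s)"
      if "s \<in> {0..t}" for s
    proof -
      have "- 2 * G 0 s = (- d\<theta> p q 0 0 (\<gamma> s) * D 0 s - 2 * d\<theta> p q 0 2 (\<gamma> s) * D 2 s) * D 0 s"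
        using Rn[OF that] D_1[OF that] by (simp add: G_def Gcoef sum_lessThan_3 power2_eq_square algebra_simps)
      with D'[OF that, of 0] show ?thesis by simp
    qed
  qed (auto intro!: continuous_intros cont_D cont_d\<theta> simp: D_0)
  have D_2: "D 2 s - 1 = 0" if "s \<in> {0..t}" for s
  \<comment> \<open>\<open>G 2\<close> is quadratic in the two velocities already known to vanish,
    so \<open>D 2\<close> keeps its initial value 1.\<close>
  proof (rule linear_ode_zero[OF _ _ _ that])
    show "((\<lambda>s. D 2 s - 1) has_real_derivative 0 * (D 2 s - 1)) (at s)" if "s \<in> {0..t}" for s
    proof -
      have "G 2 s = 0"
        using Rn[OF that] D_1[OF that] D_00[OF that] by (simp add: G_def Gcoef sum_lessThan_3)
      with D'[OF that, of 2] show ?thesis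
        by (auto intro!: derivative_eq_intros)
    qed
  qed (auto simp: D_0)
  have D: "D i s = coord_vec 2 i" if "s \<in> {0..t}" "i < 3" for i s
    using that D_1[of s] D_00[of s] D_2[of s] by (auto simp: less_3_cases)
  have "(\<lambda>i. if i < 3 then D i t else 0) = coord_vec 2"
    using D[of t] \<open>t > 0\<close> by auto
  with velocity[of t] \<open>t > 0\<close> show "velocity (warped p q) \<gamma> t = const_vec (coord_vec 2)"
    by simp
  show "\<gamma> t = (\<lambda>i. \<gamma> 0 i + t * coord_vec 2 i)"
  proof
    fix i
    show "\<gamma> t i = \<gamma> 0 i + t * coord_vec 2 i"
    proof (cases "i < 3")
      case True
      have "\<gamma> t i - (\<gamma> 0 i + t * coord_vec 2 i) = 0"
      \<comment> \<open>With coefficient 0 the lemma states that a function with zero derivative and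
        initial value 0 vanishes.\<close>
      proof (rule linear_ode_zero[of t "\<lambda>s. \<gamma> s i - (\<gamma> 0 i + s * coord_vec 2 i)" "\<lambda>_. 0"])
        show "((\<lambda>s. \<gamma> s i - (\<gamma> 0 i + s * coord_vec 2 i)) has_real_derivative
            0 * (\<gamma> s i - (\<gamma> 0 i + s * coord_vec 2 i))) (at s)" if "s \<in> {0..t}" for s
          using \<gamma>'[OF that True] D[OF that True]
          by (auto intro!: derivative_eq_intros simp del: coord_vec_apply)
      qed (use \<open>t > 0\<close> in auto)
      then show ?thesis by simp
    next
      case False
      then show ?thesis
        using Rn[of 0] Rn[of t] \<open>t > 0\<close> by (auto simp: topspace_Euclidean_space)
    qed
  qed
qed

text \<open>Normal geodesics only move vertically, which gives one inclusion; a point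
  \<open>y\<close> of the slice is reached by the line from its projection
  \<open>y(2 := 0)\<close>.\<close>

lemma parallel_hypersurface_slice:
  assumes "t > 0"
  shows "parallel_hypersurface (warped p q) (slice 0) vertical t = slice t"
proof (intro subset_antisym subsetI)
  fix y assume "y \<in> parallel_hypersurface (warped p q) (slice 0) vertical t"
  then obtain \<gamma> where \<gamma>: "\<gamma> \<in> normal_geodesics (warped p q) (slice 0) vertical t" "y = \<gamma> t"
    by (auto simp: parallel_hypersurface_def)
  then have "\<gamma> 0 \<in> slice 0" by (auto simp: normal_geodesics_def)
  then show "y \<in> slice t"
    unfolding \<gamma>(2) normal_geodesic_eq_line(1)[OF \<gamma>(1) assms]
    by (auto simp: slice_def topspace_Euclidean_space)
next
  fix y assume y: "y \<in> slice t"
  then have "y(2 := 0) \<in> slice 0" by (auto simp: slice_def Rn_upd)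
  from line_normal_geodesic[OF this, of p q t]
  show "y \<in> parallel_hypersurface (warped p q) (slice 0) vertical t"
    unfolding parallel_hypersurface_def
    by (rule image_eqI[rotated]) (use y in \<open>auto simp: slice_def\<close>)
qed

text \<open>Some normal geodesic ends at \<open>y\<close> because the slice is the parallel
  hypersurface, and all of them arrive with velocity d/dx^2.\<close>

lemma parallel_normal_slice:
  assumes "t > 0" "y \<in> slice t"
  shows "parallel_normal (warped p q) (slice 0) vertical t y = const_vec (coord_vec 2)"
  unfolding parallel_normal_def
proof (rule the_equality)
  obtain \<gamma> where "\<gamma> \<in> normal_geodesics (warped p q) (slice 0) vertical t" "y = \<gamma> t"
    using assms(2) unfolding parallel_hypersurface_slice[of t p q, OF assms(1), symmetric] parallel_hypersurface_def
    by blast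
  then show "\<exists>\<gamma>\<in>normal_geodesics (warped p q) (slice 0) vertical t.
      \<gamma> t = y \<and> velocity (warped p q) \<gamma> t = const_vec (coord_vec 2)"
    using normal_geodesic_eq_line(2) assms(1) by blast
qed (use normal_geodesic_eq_line(2) assms(1) in blast)

lemma has_parallel_hypersurfaces_slice:
  "has_parallel_hypersurfaces (warped p q) (slice 0) vertical"
  unfolding has_parallel_hypersurfaces_def
proof (intro exI[of _ 1] conjI ballI impI)
  fix t :: real assume "t \<in> {0<..<1}"
  then have t: "t > 0" by simp
  show "\<exists>\<gamma>\<in>normal_geodesics (warped p q) (slice 0) vertical t. \<gamma> 0 = x" if "x \<in> slice 0" for x
    using line_normal_geodesic[OF that] by (rule bexI[rotated]) simp
  show "velocity (warped p q) \<gamma> t = velocity (warped p q) \<eta> t"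
    if "\<gamma> \<in> normal_geodesics (warped p q) (slice 0) vertical t"
      "\<eta> \<in> normal_geodesics (warped p q) (slice 0) vertical t" for \<gamma> \<eta>
    using that t by (simp add: normal_geodesic_eq_line(2))
  show "hypersurface_with_normal (warped p q)
      (parallel_hypersurface (warped p q) (slice 0) vertical t)
      (parallel_normal (warped p q) (slice 0) vertical t)"
    unfolding parallel_hypersurface_slice[OF t]
    by (rule hypersurface_with_normal_slice) (rule parallel_normal_slice[OF t])
qed simp

section \<open>Isoparametricity and constancy of the principal curvatures in terms of
  \<open>p\<close> and \<open>q\<close>\<close>

lemma mean_curvature_slice:
  assumes "x \<in> slice t" and "\<And>x. x \<in> slice t \<Longrightarrow> \<nu> x = const_vec (coord_vec 2)"
  shows "mean_curvature (warped p q) (slice t) \<nu> x = - 2 * q * x 0 * t"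
  using assms(1)[unfolded slice_def]
  \<comment> \<open>The contributions of \<open>p\<close> to the two principal curvatures
    cancel.\<close>
  by (simp add: mean_curvature_def principal_curvatures_slice[OF assms] d\<theta>_def)

lemma isoparametric_slice_iff:
  "isoparametric (warped p q) (slice 0) vertical \<longleftrightarrow> q = 0"
proof
  assume "isoparametric (warped p q) (slice 0) vertical"
  then obtain \<epsilon> :: real where \<epsilon>: "\<epsilon> > 0" "\<And>t. t \<in> {0<..<\<epsilon>} \<Longrightarrow> constant_mean_curvature (warped p q)
      (parallel_hypersurface (warped p q) (slice 0) vertical t)
      (parallel_normal (warped p q) (slice 0) vertical t)"
    by (auto simp: isoparametric_def)
  define t where "t = \<epsilon> / 2"
  have t: "t > 0" "t \<in> {0<..<\<epsilon>}" using \<epsilon>(1) by (auto simp: t_def)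
  from \<epsilon>(2)[OF t(2)] obtain H where "mean_curvature (warped p q) (slice t)
      (parallel_normal (warped p q) (slice 0) vertical t) x = H" if "x \<in> slice t" for x
    by (auto simp: constant_mean_curvature_def parallel_hypersurface_slice[OF t(1)])
  then have "- 2 * q * x 0 * t = H" if "x \<in> slice t" for x
    using that mean_curvature_slice[of x t "parallel_normal (warped p q) (slice 0) vertical t" p q]
      parallel_normal_slice[OF t(1), of _ p q] by simp
  \<comment> \<open>At (0, 0, t) and (1, 0, t) the mean curvatures are 0 and - 2 q t.\<close>
  from this[of "\<lambda>i. t * coord_vec 2 i"] this[of "\<lambda>i. coord_vec 0 i + t * coord_vec 2 i"] show "q = 0"
    using t(1) by (auto simp: slice_def topspace_Euclidean_space)
next
  assume "q = 0"
  then have "constant_mean_curvature (warped p q) (slice t) \<nu>"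
    if "\<And>x. x \<in> slice t \<Longrightarrow> \<nu> x = const_vec (coord_vec 2)" for t \<nu>
    unfolding constant_mean_curvature_def
    by (intro exI[of _ 0]) (simp add: mean_curvature_slice[OF _ that])
  then show "isoparametric (warped p q) (slice 0) vertical"
    by (auto simp: isoparametric_def parallel_hypersurface_slice parallel_normal_slice
        intro!: exI[of _ "1::real"])
qed

text \<open>On \<open>slice 0\<close> the factor x^2 removes \<open>q\<close>, leaving the principal
  curvatures - p x^0 and p x^0; the origin and (1, 0, 0) tell them apart unless p = 0.\<close>

lemma constant_principal_curvatures_slice_iff:
  "constant_principal_curvatures (warped p q) (slice 0) vertical \<longleftrightarrow> p = 0"
proof
  assume "constant_principal_curvatures (warped p q) (slice 0) vertical"
  then obtain P where "{#- d\<theta> p q 0 2 x, - d\<theta> p q 1 2 x#} = P" if "x \<in> slice 0" for x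
    by (auto simp: constant_principal_curvatures_def principal_curvatures_slice)
  from this[of "\<lambda>_. 0"] this[of "coord_vec 0"]
  have "{#- p, p#} = {#0, 0#}"
    by (simp add: slice_def topspace_Euclidean_space d\<theta>_def)
  then have "p \<in># {#0, 0#}"
    by (metis add_mset_commute union_single_eq_member)
  then show "p = 0" by simp
next
  assume "p = 0"
  then show "constant_principal_curvatures (warped p q) (slice 0) vertical"
    unfolding constant_principal_curvatures_def
    by (intro exI[of _ "{#0, 0#}"]) (simp add: principal_curvatures_slice, simp add: d\<theta>_def slice_def)
qed

theorem theorem1p1:
  shows "(\<exists>(N :: (nat \<Rightarrow> real) finsler) M \<nu>.
            finsler_manifold N \<and> \<not> constant_flag_curvature N \<and>
            hypersurface_with_normal N M \<nu> \<and> has_parallel_hypersurfaces N M \<nu> \<and>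
            isoparametric N M \<nu> \<and> \<not> constant_principal_curvatures N M \<nu>) \<and>
         (\<exists>(N :: (nat \<Rightarrow> real) finsler) M \<nu>.
            finsler_manifold N \<and> \<not> constant_flag_curvature N \<and>
            hypersurface_with_normal N M \<nu> \<and> has_parallel_hypersurfaces N M \<nu> \<and>
            constant_principal_curvatures N M \<nu> \<and> \<not> isoparametric N M \<nu>)"
proof (intro conjI)
  note slice_0 = finsler_manifold_warped hypersurface_with_normal_slice[OF refl]
    has_parallel_hypersurfaces_slice
  show "\<exists>(N :: (nat \<Rightarrow> real) finsler) M \<nu>.
      finsler_manifold N \<and> \<not> constant_flag_curvature N \<and>
      hypersurface_with_normal N M \<nu> \<and> has_parallel_hypersurfaces N M \<nu> \<and>
      isoparametric N M \<nu> \<and> \<not> constant_principal_curvatures N M \<nu>"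
    \<comment> \<open>In \<open>not_constant_flag_curvature\<close> the variable \<open>q\<close>
      comes first, so all three instances have p = 1 and q = 0.\<close>
    using not_constant_flag_curvature[of 0 1] isoparametric_slice_iff[of 1 0]
      constant_principal_curvatures_slice_iff[of 1 0]
    by (intro exI[of _ "warped 1 0"] exI[of _ "slice 0"] exI[of _ vertical] conjI slice_0) simp_all
  show "\<exists>(N :: (nat \<Rightarrow> real) finsler) M \<nu>.
      finsler_manifold N \<and> \<not> constant_flag_curvature N \<and>
      hypersurface_with_normal N M \<nu> \<and> has_parallel_hypersurfaces N M \<nu> \<and>
      constant_principal_curvatures N M \<nu> \<and> \<not> isoparametric N M \<nu>"
    \<comment> \<open>Here p = 0 and q = 1, again with \<open>q\<close> first in the curvature
      lemma.\<close>
    using not_constant_flag_curvature[of 1 0] isoparametric_slice_iff[of 0 1]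
      constant_principal_curvatures_slice_iff[of 0 1]
    by (intro exI[of _ "warped 0 1"] exI[of _ "slice 0"] exI[of _ vertical] conjI slice_0) simp_all
qed

end
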